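(* Let $A$ be a normal $n\times n$ complex matrix and let $Z$ be an $n\times n$ expansive matrix, i.e. $Z^*Z\ge I$. If $f:[0,\infty)\to[0,\infty)$ is concave, then for every symmetric norm, $$\|\, f(|Z^*AZ|)\,\| \le \|\, Z^*f(|A|)Z\,\|.$$
   Context: For a matrix $X$, $|X|=(X^*X)^{1/2}$, and $f(|X|)$ is defined by the functional calculus. $Z^*Z\ge I$ is in the positive semi-definite order. A symmetric (unitarily invariant) norm is a norm on $n\times n$ matrices satisfying $\|UXV\|=\|X\|$ for all matrices $X$ and all unitaries $U,V$. *)

theory Defs
  imports "HOL-Analysis.Convex" "Jordan_Normal_Form.Schur_Decomposition"
begin

definition unitary_mat :: "nat \<Rightarrow> complex mat \<Rightarrow> bool" where
  "unitary_mat n U \<longleftrightarrow> U \<in> carrier_mat n n \<and>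
     mat_adjoint U * U = 1\<^sub>m n \<and> U * mat_adjoint U = 1\<^sub>m n"

definition normal_mat :: "nat \<Rightarrow> complex mat \<Rightarrow> bool" where
  "normal_mat n A \<longleftrightarrow> A \<in> carrier_mat n n \<and> mat_adjoint A * A = A * mat_adjoint A"

definition psd_mat :: "nat \<Rightarrow> complex mat \<Rightarrow> bool" where
  "psd_mat n X \<longleftrightarrow> X \<in> carrier_mat n n \<and> mat_adjoint X = X \<and>
     (\<forall>v \<in> carrier_vec n. 0 \<le> Re ((X *\<^sub>v v) \<bullet>c v))"

definition loewner_le :: "nat \<Rightarrow> complex mat \<Rightarrow> complex mat \<Rightarrow> bool" where
  "loewner_le n X Y \<longleftrightarrow> X \<in> carrier_mat n n \<and> Y \<in> carrier_mat n n \<and> psd_mat n (Y - X)"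

definition expansive_mat :: "nat \<Rightarrow> complex mat \<Rightarrow> bool" where
  "expansive_mat n Z \<longleftrightarrow> Z \<in> carrier_mat n n \<and> loewner_le n (1\<^sub>m n) (mat_adjoint Z * Z)"

text \<open>Functional calculus for Hermitian matrices: if H = U D U^* with U unitary and
  D real diagonal, then f(H) = U f(D) U^*, where f(D) applies f to the diagonal entries.
  (This is independent of the chosen decomposition.)\<close>
definition real_diag_mat :: "nat \<Rightarrow> complex mat \<Rightarrow> bool" where
  "real_diag_mat n D \<longleftrightarrow> D \<in> carrier_mat n n \<and> diagonal_mat D \<and>
     (\<forall>i<n. D $$ (i,i) \<in> \<real>)"

definition diag_apply :: "nat \<Rightarrow> (real \<Rightarrow> real) \<Rightarrow> complex mat \<Rightarrow> complex mat" where
  "diag_apply n f D = mat n n (\<lambda>(i,j). if i = j then complex_of_real (f (Re (D $$ (i,i)))) else 0)"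

definition mat_fun :: "nat \<Rightarrow> (real \<Rightarrow> real) \<Rightarrow> complex mat \<Rightarrow> complex mat" where
  "mat_fun n f H = (SOME B. \<exists>U D. unitary_mat n U \<and> real_diag_mat n D \<and>
      H = U * D * mat_adjoint U \<and> B = U * diag_apply n f D * mat_adjoint U)"

definition mat_abs :: "nat \<Rightarrow> complex mat \<Rightarrow> complex mat" where
  "mat_abs n X = mat_fun n sqrt (mat_adjoint X * X)"

definition symmetric_norm :: "nat \<Rightarrow> (complex mat \<Rightarrow> real) \<Rightarrow> bool" where
  "symmetric_norm n N \<longleftrightarrow>
     (\<forall>X \<in> carrier_mat n n. 0 \<le> N X) \<and>
     (\<forall>X \<in> carrier_mat n n. N X = 0 \<longleftrightarrow> X = 0\<^sub>m n n) \<and>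
     (\<forall>X \<in> carrier_mat n n. \<forall>c. N (c \<cdot>\<^sub>m X) = cmod c * N X) \<and>
     (\<forall>X \<in> carrier_mat n n. \<forall>Y \<in> carrier_mat n n. N (X + Y) \<le> N X + N Y) \<and>
     (\<forall>X \<in> carrier_mat n n. \<forall>U V. unitary_mat n U \<longrightarrow> unitary_mat n V \<longrightarrow>
        N (U * X * V) = N X)"

end

theory Submission
  imports Defs "Jordan_Normal_Form.Spectral_Radius"
begin

text \<open>
  Diagonalise \<open>A = diag a\<close>, write \<open>a = \<Phi> \<alpha>\<close> with \<open>\<alpha> = |a|\<close> and phases \<open>\<Phi>\<close>, and put \<open>K = Z Z\<^sup>* \<ge> I\<close> and
  \<open>L = (K + \<Phi>\<^sup>* K \<Phi>) / 2 \<ge> I\<close>. The singular values of \<open>Z\<^sup>* A Z\<close> are dominated one by one by the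
  eigenvalues \<open>\<lambda>\<close> of \<open>\<alpha>\<^sup>\<onehalf> L \<alpha>\<^sup>\<onehalf>\<close>, so it suffices to treat the positive matrix \<open>\<alpha>\<close> and \<open>L\<close>, the
  averaging in \<open>L\<close> being harmless because \<open>\<Phi>\<close> commutes with \<open>f \<alpha>\<close>.

  Factor \<open>L = C C\<^sup>*\<close> so that \<open>C\<^sup>* \<alpha> C = diag \<lambda>\<close> with \<open>\<lambda>\<close> decreasing. The partial sums of \<open>f \<lambda>\<close> are
  bounded by those of the diagonal of \<open>C\<^sup>* f(\<alpha>) C\<close>: this is linear in \<open>f\<close>, and on finitely many points \<open>f\<close>
  is a nonnegative combination of the constant 1 and the functions \<open>min t a\<close>, for which it can be
  checked directly. Weak majorization and pinching turn the partial sums into the norm inequality.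
\<close>

section \<open>Adjoints, unitary matrices and orthonormal systems\<close>

text \<open>The averaged matrix \<open>L\<close> is forced by the phases, since comparing
  \<open>Z\<^sup>* A Z\<close> with \<open>Z\<^sup>* |A| Z\<close> fails. Take
  \<open>A = diag(1,-1)\<close> and \<open>Z\<close> positive with eigenvalues
  \<open>b > c \<ge> 1\<close> on the vectors (1,1) and (1,-1). Both singular values of
  \<open>Z\<^sup>* A Z\<close> are \<open>b c\<close>, the eigenvalues of
  \<open>Z\<^sup>* |A| Z\<close> are \<open>b\<^sup>2\<close> and \<open>c\<^sup>2\<close>, and for
  \<open>f t = min t (b c)\<close> the trace norms are \<open>2 b c\<close> and the smaller
  \<open>b c + c\<^sup>2\<close>. Here \<open>L\<close> is the scalar
  \<open>(b\<^sup>2 + c\<^sup>2) / 2\<close>, which restores the domination. The check for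
  \<open>min t a\<close> is carried out on \<open>max 0 (t - a)\<close>: the two add up to
  \<open>t\<close>, for which both sides agree because \<open>lam\<close> is the diagonal of
  \<open>C\<^sup>* \<alpha> C\<close>. The convex part sees only the rows with
  \<open>a < \<alpha> i\<close>, and on these \<open>L \<ge> I\<close> supplies enough mass to pay
  for the subtracted level \<open>a\<close>.\<close>

lemma adjoint_dim [simp]:
  "dim_row (mat_adjoint A) = dim_col A" "dim_col (mat_adjoint A) = dim_row A"
  by (simp_all add: mat_adjoint_def)

lemma adjoint_carrier [simp]: "A \<in> carrier_mat n m \<Longrightarrow> mat_adjoint A \<in> carrier_mat m n"
  by (metis adjoint_dim carrier_matD carrier_matI)

lemma adjoint_index [simp]:
  fixes A :: "complex mat"
  shows "i < dim_col A \<Longrightarrow> j < dim_row A \<Longrightarrow> mat_adjoint A $$ (i,j) = cnj (A $$ (j,i))"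
  by (simp add: mat_adjoint_def mat_of_rows_index)

lemma mult_index:
  assumes "A \<in> carrier_mat n m" "B \<in> carrier_mat m k" "i < n" "j < k"
  shows "(A * B) $$ (i,j) = (\<Sum>l<m. A $$ (i,l) * B $$ (l,j))"
  using assms by (simp add: scalar_prod_def atLeast0LessThan)

lemma mult_vec_index:
  assumes "A \<in> carrier_mat n m" "v \<in> carrier_vec m" "i < n"
  shows "(A *\<^sub>v v) $ i = (\<Sum>l<m. A $$ (i,l) * v $ l)"
  using assms by (simp add: scalar_prod_def atLeast0LessThan)

lemma adjoint_adjoint [simp]:
  fixes A :: "complex mat"
  shows "mat_adjoint (mat_adjoint A) = A"
  by (rule eq_matI) simp_all

lemma adjoint_mult:
  fixes A B :: "complex mat"
  assumes "dim_col A = dim_row B"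
  shows "mat_adjoint (A * B) = mat_adjoint B * mat_adjoint A"
  by (rule eq_matI) (use assms in \<open>simp_all add: scalar_prod_def mult.commute\<close>)

lemma adjoint_add:
  fixes A B :: "complex mat"
  assumes "dim_row A = dim_row B" "dim_col A = dim_col B"
  shows "mat_adjoint (A + B) = mat_adjoint A + mat_adjoint B"
  by (rule eq_matI) (use assms in simp_all)

lemma adjoint_smult:
  fixes A :: "complex mat"
  shows "mat_adjoint (c \<cdot>\<^sub>m A) = cnj c \<cdot>\<^sub>m mat_adjoint A"
  by (rule eq_matI) simp_all

lemma mat_diag_dims [simp]: "dim_row (mat_diag n x) = n" "dim_col (mat_diag n x) = n"
  by (simp_all add: mat_diag_def)

lemma mat_diag_index [simp]: "i < n \<Longrightarrow> j < n \<Longrightarrow> mat_diag n x $$ (i,j) = (if i = j then x i else 0)"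
  by (simp add: mat_diag_def)

lemma adjoint_mat_diag [simp]: "mat_adjoint (mat_diag n x) = mat_diag n (\<lambda>i. cnj (x i))"
  by (rule eq_matI) auto

lemma mat_diag_cong: "(\<And>i. i < n \<Longrightarrow> x i = y i) \<Longrightarrow> mat_diag n x = mat_diag n y"
  by (rule eq_matI) auto

text \<open>Associativity with dimensions as side conditions: as a rewrite rule it nests every
  product to the right, the form in which the cancellation laws for unitaries apply.\<close>

lemma mult_assoc_dim:
  fixes A B C :: "'a::semiring_0 mat"
  assumes "dim_col A = dim_row B" "dim_col B = dim_row C"
  shows "A * B * C = A * (B * C)"
  by (rule assoc_mult_mat[of _ "dim_row A" "dim_col A" _ "dim_col B" _ "dim_col C"])
     (use assms in auto)

lemma unitary_dim:
  assumes "unitary_mat n U"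
  shows "U \<in> carrier_mat n n" "dim_row U = n" "dim_col U = n"
  using assms by (auto simp: unitary_mat_def)

lemma unitary_cancel:
  assumes "unitary_mat n U"
  shows "mat_adjoint U * U = 1\<^sub>m n" "U * mat_adjoint U = 1\<^sub>m n"
    "dim_row X = n \<Longrightarrow> mat_adjoint U * (U * X) = X"
    "dim_row X = n \<Longrightarrow> U * (mat_adjoint U * X) = X"
proof -
  note u = unitary_dim[OF assms]
  show 1: "mat_adjoint U * U = 1\<^sub>m n" "U * mat_adjoint U = 1\<^sub>m n"
    using assms by (auto simp: unitary_mat_def)
  assume "dim_row X = n"
  then have X: "X \<in> carrier_mat n (dim_col X)" by auto
  show "mat_adjoint U * (U * X) = X" "U * (mat_adjoint U * X) = X"
    using 1 u X left_mult_one_mat[OF X]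
    by (simp_all add: mult_assoc_dim[symmetric])
qed

lemma unitaryI:
  assumes "U \<in> carrier_mat n n" "mat_adjoint U * U = 1\<^sub>m n"
  shows "unitary_mat n U"
  using assms mat_mult_left_right_inverse[of "mat_adjoint U" n U] by (simp add: unitary_mat_def)

lemma unitary_adjoint: "unitary_mat n U \<Longrightarrow> unitary_mat n (mat_adjoint U)"
  by (simp add: unitary_mat_def)

lemma unitary_mult:
  assumes "unitary_mat n U" "unitary_mat n V"
  shows "unitary_mat n (U * V)"
  using unitary_dim[OF assms(1)] unitary_dim[OF assms(2)]
    unitary_cancel[OF assms(1)] unitary_cancel[OF assms(2)]
  by (intro unitaryI) (auto simp: adjoint_mult mult_assoc_dim)

lemma unitary_one: "unitary_mat n (1\<^sub>m n)"
proof -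
  have "mat_adjoint (1\<^sub>m n) = (1\<^sub>m n :: complex mat)" by (rule eq_matI) auto
  then show ?thesis by (simp add: unitary_mat_def)
qed

lemma unitary_mat_diag:
  assumes "\<And>i. i < n \<Longrightarrow> cmod (x i) = 1"
  shows "unitary_mat n (mat_diag n x)"
proof (rule unitaryI)
  have "mat_adjoint (mat_diag n x) * mat_diag n x = mat_diag n (\<lambda>i. cnj (x i) * x i)" by simp
  also have "\<dots> = mat_diag n (\<lambda>i. 1)"
    by (rule mat_diag_cong) (metis assms complex_norm_square mult.commute of_real_1 one_power2)
  finally show "mat_adjoint (mat_diag n x) * mat_diag n x = 1\<^sub>m n" by simp
qed simp

text \<open>A square matrix whose row \<open>r\<close> is zero has determinant 0 and so kills a
  nonzero vector. Rows beyond \<open>r\<close> only add equations, which are dropped.\<close>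

lemma homogeneous_system_nontrivial:
  fixes m :: "nat \<Rightarrow> nat \<Rightarrow> complex"
  assumes "r < n"
  shows "\<exists>v. (\<exists>l<n. v l \<noteq> 0) \<and> (\<forall>i<r. (\<Sum>l<n. m i l * v l) = 0)"
proof -
  define M where "M = mat\<^sub>r n n (\<lambda>i. if i = r then 0\<^sub>v n else vec n (m i))"
  have M: "M \<in> carrier_mat n n" by (simp add: M_def)
  have "det M = 0" unfolding M_def by (rule det_row_0[OF assms]) auto
  then obtain v where v: "v \<in> carrier_vec n" "v \<noteq> 0\<^sub>v n" "M *\<^sub>v v = 0\<^sub>v n"
    using det_0_iff_vec_prod_zero[OF M] by auto
  have "\<exists>l<n. v $ l \<noteq> 0"
    using v(1,2) by (metis carrier_vecD eq_vecI index_zero_vec(1) index_zero_vec(2))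
  moreover have "(\<Sum>l<n. m i l * v $ l) = 0" if "i < r" for i
  proof -
    have "(M *\<^sub>v v) $ i = (\<Sum>l<n. M $$ (i,l) * v $ l)"
      using that assms by (intro mult_vec_index[OF M v(1)]) auto
    also have "\<dots> = (\<Sum>l<n. m i l * v $ l)"
      using that assms by (intro sum.cong) (auto simp: M_def mat_of_rows_def)
    finally show ?thesis using v(3) that assms by simp
  qed
  ultimately show ?thesis by blast
qed

lemma unit_scaling:
  fixes v :: "nat \<Rightarrow> complex"
  assumes "\<exists>l<n. v l \<noteq> 0"
  shows "\<exists>c. c \<noteq> 0 \<and> (\<Sum>l<n. cnj (c * v l) * (c * v l)) = 1"
proof -
  define s where "s = (\<Sum>l<n. (cmod (v l))\<^sup>2)"
  obtain k where k: "k < n" "v k \<noteq> 0" using assms by auto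
  have "(cmod (v k))\<^sup>2 \<le> s" unfolding s_def by (rule member_le_sum) (use k in auto)
  then have s: "s > 0" using k by (smt (verit) zero_less_norm_iff zero_less_power)
  define c where "c = complex_of_real (1 / sqrt s)"
  have "(\<Sum>l<n. cnj (c * v l) * (c * v l)) = (\<Sum>l<n. (1 / s) * ((cmod (v l))\<^sup>2))"
    unfolding of_real_sum
  proof (rule sum.cong[OF refl])
    fix l
    have "cnj (c * v l) * (c * v l) = of_real ((cmod (c * v l))\<^sup>2)"
      by (subst complex_norm_square) (simp add: mult.commute)
    also have "(cmod (c * v l))\<^sup>2 = (1 / s) * ((cmod (v l))\<^sup>2)"
      using s by (simp add: c_def norm_mult norm_divide power_mult_distrib power_divide)
    finally show "cnj (c * v l) * (c * v l) = complex_of_real ((1 / s) * ((cmod (v l))\<^sup>2))" .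
  qed
  also have "\<dots> = of_real (1 / s * s)" by (simp add: s_def sum_distrib_left)
  also have "\<dots> = 1" using s by simp
  finally show ?thesis using s by (intro exI[of _ c]) (simp add: c_def)
qed

text \<open>Fewer than \<open>n\<close> vectors leave a nonzero solution of the orthogonality
  equations; normalise it and repeat.\<close>

lemma orthonormal_extend:
  fixes u :: "nat \<Rightarrow> nat \<Rightarrow> complex"
  assumes "r \<le> k" "k \<le> n"
    and "\<And>i j. i < r \<Longrightarrow> j < r \<Longrightarrow> (\<Sum>l<n. cnj (u i l) * u j l) = (if i = j then 1 else 0)"
  shows "\<exists>w. (\<forall>i<r. w i = u i) \<and>
    (\<forall>i<k. \<forall>j<k. (\<Sum>l<n. cnj (w i l) * w j l) = (if i = j then 1 else 0))"
  using assms(1,2)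
proof (induction k rule: dec_induct)
  case base
  then show ?case using assms(3) by blast
next
  case (step k)
  then obtain w where w: "\<forall>i<r. w i = u i"
    "\<forall>i<k. \<forall>j<k. (\<Sum>l<n. cnj (w i l) * w j l) = (if i = j then 1 else 0)" by auto
  obtain v where v: "\<exists>l<n. v l \<noteq> 0" "\<forall>i<k. (\<Sum>l<n. cnj (w i l) * v l) = 0"
    using homogeneous_system_nontrivial[of k n "\<lambda>i l. cnj (w i l)"] step by auto
  obtain c where c: "c \<noteq> 0" "(\<Sum>l<n. cnj (c * v l) * (c * v l)) = 1"
    using unit_scaling[OF v(1)] by auto
  define w' where "w' = w(k := \<lambda>l. c * v l)"
  have o1: "(\<Sum>l<n. cnj (w i l) * (c * v l)) = 0" if "i < k" for i
    using v(2) that by (simp add: mult.left_commute[of _ c] flip: sum_distrib_left)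
  have o2: "(\<Sum>l<n. cnj (c * v l) * w i l) = 0" if "i < k" for i
  proof -
    have "(\<Sum>l<n. cnj (c * v l) * w i l) = cnj (\<Sum>l<n. cnj (w i l) * (c * v l))"
      by (simp add: mult.commute)
    then show ?thesis using o1[OF that] by simp
  qed
  have "(\<Sum>l<n. cnj (w' i l) * w' j l) = (if i = j then 1 else 0)" if "i < Suc k" "j < Suc k" for i j
  proof (cases "i = k"; cases "j = k")
    assume "i = k" "j = k" then show ?thesis using c(2) by (simp add: w'_def)
  next
    assume "i = k" "j \<noteq> k" then show ?thesis using o2[of j] that by (simp add: w'_def)
  next
    assume "i \<noteq> k" "j = k" then show ?thesis using o1[of i] that by (simp add: w'_def)
  next
    assume "i \<noteq> k" "j \<noteq> k" then show ?thesis using w(2) that by (simp add: w'_def)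
  qed
  moreover have "\<forall>i<r. w' i = u i" using w(1) step by (simp add: w'_def)
  ultimately show ?case by blast
qed

lemma unitary_of_orthonormal:
  assumes "\<And>i j. i < n \<Longrightarrow> j < n \<Longrightarrow> (\<Sum>l<n. cnj (u i l) * u j l) = (if i = j then 1 else 0)"
  shows "unitary_mat n (mat n n (\<lambda>(l,i). u i l))"
proof (rule unitaryI)
  show "mat_adjoint (mat n n (\<lambda>(l,i). u i l)) * mat n n (\<lambda>(l,i). u i l) = 1\<^sub>m n"
    by (rule eq_matI) (use assms in \<open>auto simp: mult_index[of _ n n _ n] simp del: index_mult_mat(1)\<close>)
qed simp

lemma unitary_orthonormal:
  assumes "unitary_mat n U" "i < n" "j < n"
  shows "(\<Sum>l<n. cnj (U $$ (l,i)) * U $$ (l,j)) = (if i = j then 1 else 0)"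
proof -
  have "(mat_adjoint U * U) $$ (i,j) = (\<Sum>l<n. cnj (U $$ (l,i)) * U $$ (l,j))"
    using assms unitary_dim[OF assms(1)] by (subst mult_index[of _ n n _ n]) auto
  then show ?thesis using assms unitary_cancel(1)[OF assms(1)] by simp
qed

section \<open>Spectral theorem for normal matrices\<close>

text \<open>Since \<open>A\<close> commutes with its adjoint, \<open>y = A\<^sup>* x\<close>
  satisfies \<open>A y = a y\<close> along with \<open>x\<close>. All inner products of
  \<open>x\<close> and \<open>y\<close> are then multiples of the squared norm of \<open>x\<close>,
  and the squared norm of \<open>y - cnj a x\<close> expands to 0.\<close>

lemma normal_eigenvector_adjoint:
  fixes A :: "complex mat"
  assumes A: "normal_mat n A" and v: "\<And>i. i < n \<Longrightarrow> (\<Sum>l<n. A $$ (i,l) * v l) = a * v i" and "i < n"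
  shows "(\<Sum>l<n. mat_adjoint A $$ (i,l) * v l) = cnj a * v i"
proof -
  have Ac: "A \<in> carrier_mat n n" and comm: "mat_adjoint A * A = A * mat_adjoint A"
    using A by (auto simp: normal_mat_def)
  define x where "x = vec n v"
  have x: "x \<in> carrier_vec n" by (simp add: x_def)
  have Ax: "A *\<^sub>v x = a \<cdot>\<^sub>v x"
    using Ac v by (intro eq_vecI) (auto simp: x_def scalar_prod_def atLeast0LessThan)
  define y where "y = mat_adjoint A *\<^sub>v x"
  have y: "y \<in> carrier_vec n" using Ac by (intro carrier_vecI) (simp add: y_def)
  have Ay: "A *\<^sub>v y = a \<cdot>\<^sub>v y"
  proof -
    have "A *\<^sub>v y = (A * mat_adjoint A) *\<^sub>v x"
      unfolding y_def using Ac x by (intro assoc_mult_mat_vec[symmetric, of _ n n _ n]) auto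
    also have "\<dots> = mat_adjoint A *\<^sub>v (A *\<^sub>v x)"
      unfolding comm[symmetric] using Ac x by (intro assoc_mult_mat_vec[of _ n n _ n]) auto
    also have "\<dots> = a \<cdot>\<^sub>v y"
      unfolding Ax y_def using Ac x by (intro mult_mat_vec) auto
    finally show ?thesis .
  qed
  have ip: "(\<Sum>i<n. cnj (y $ i) * p i) = (\<Sum>l<n. cnj (x $ l) * (\<Sum>i<n. A $$ (l,i) * p i))" for p
  proof -
    have "(\<Sum>i<n. cnj (y $ i) * p i) = (\<Sum>i<n. \<Sum>l<n. A $$ (l,i) * cnj (x $ l) * p i)"
      unfolding y_def
      by (intro sum.cong refl)
        (use Ac x in \<open>simp add: mult_vec_index[of _ n n] sum_distrib_right del: index_mult_mat_vec\<close>)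
    also have "\<dots> = (\<Sum>l<n. \<Sum>i<n. A $$ (l,i) * cnj (x $ l) * p i)" by (rule sum.swap)
    finally show ?thesis by (simp add: sum_distrib_left mult_ac)
  qed
  have Axi: "(\<Sum>i<n. A $$ (l,i) * x $ i) = a * x $ l" if "l < n" for l
    using v that by (simp add: x_def)
  have Ayi: "(\<Sum>i<n. A $$ (l,i) * y $ i) = a * y $ l" if "l < n" for l
    using arg_cong[OF Ay, of "\<lambda>z. z $ l"] that Ac y mult_vec_index[OF Ac y that] by simp
  define s where "s = (\<Sum>i<n. cnj (x $ i) * x $ i)"
  have yx: "(\<Sum>i<n. cnj (y $ i) * x $ i) = a * s"
  proof -
    have "(\<Sum>i<n. cnj (y $ i) * x $ i) = (\<Sum>l<n. cnj (x $ l) * (a * x $ l))"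
      unfolding ip by (intro sum.cong refl) (simp add: Axi)
    then show ?thesis by (simp add: s_def sum_distrib_left mult_ac)
  qed
  have xy: "(\<Sum>i<n. cnj (x $ i) * y $ i) = cnj a * cnj s"
    using arg_cong[OF yx, of cnj] by (simp add: mult.commute)
  have yy: "(\<Sum>i<n. cnj (y $ i) * y $ i) = a * (cnj a * cnj s)"
  proof -
    have "(\<Sum>i<n. cnj (y $ i) * y $ i) = (\<Sum>l<n. cnj (x $ l) * (a * y $ l))"
      unfolding ip by (intro sum.cong refl) (simp add: Ayi)
    also have "\<dots> = a * (\<Sum>l<n. cnj (x $ l) * y $ l)" by (simp add: sum_distrib_left mult_ac)
    finally show ?thesis by (simp add: xy)
  qed
  have cs: "cnj s = s" unfolding s_def by (simp add: mult.commute)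
  have "(\<Sum>i<n. cnj (y $ i - cnj a * x $ i) * (y $ i - cnj a * x $ i))
    = (\<Sum>i<n. cnj (y $ i) * y $ i) - cnj a * (\<Sum>i<n. cnj (y $ i) * x $ i)
      - a * (\<Sum>i<n. cnj (x $ i) * y $ i) + a * cnj a * s"
    unfolding s_def by (simp add: algebra_simps sum.distrib sum_subtractf sum_distrib_left)
  also have "\<dots> = 0" unfolding yx xy yy cs by (simp add: algebra_simps)
  finally have "complex_of_real (\<Sum>i<n. (cmod (y $ i - cnj a * x $ i))\<^sup>2) = 0"
    unfolding of_real_sum by (subst complex_norm_square) (simp add: mult.commute)
  then have "(\<Sum>i<n. (cmod (y $ i - cnj a * x $ i))\<^sup>2) = 0" using of_real_eq_0_iff by blast
  then have "y $ i - cnj a * x $ i = 0"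
    using \<open>i < n\<close> by (subst (asm) sum_nonneg_eq_0_iff) auto
  then have "y $ i = cnj a * v i" using \<open>i < n\<close> by (simp add: x_def)
  moreover have "y $ i = (\<Sum>l<n. mat_adjoint A $$ (i,l) * x $ l)"
    unfolding y_def by (rule mult_vec_index) (use Ac x \<open>i < n\<close> in auto)
  moreover have "\<dots> = (\<Sum>l<n. mat_adjoint A $$ (i,l) * v l)"
    by (simp add: x_def)
  ultimately show ?thesis by simp
qed

lemma complex_eigenvector_exists:
  fixes B :: "complex mat"
  assumes B: "B \<in> carrier_mat m m" and "m > 0"
  shows "\<exists>w b. (\<exists>l<m. w l \<noteq> 0) \<and> (\<forall>i<m. (\<Sum>l<m. B $$ (i,l) * w l) = b * w i)"
proof -
  obtain b where "eigenvalue B b" using spectrum_non_empty[OF assms] by (auto simp: spectrum_def)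
  then obtain v where v: "v \<in> carrier_vec m" "v \<noteq> 0\<^sub>v m" "B *\<^sub>v v = b \<cdot>\<^sub>v v"
    using B by (auto simp: eigenvalue_def eigenvector_def)
  have "\<exists>l<m. v $ l \<noteq> 0"
    using v(1,2) by (metis carrier_vecD eq_vecI index_zero_vec(1) index_zero_vec(2))
  moreover have "(\<Sum>l<m. B $$ (i,l) * v $ l) = b * v $ i" if "i < m" for i
    using mult_vec_index[OF B v(1) that] v that by simp
  ultimately show ?thesis by blast
qed

text \<open>In an orthonormal basis whose first \<open>k\<close> members are eigenvectors,
  \<open>A\<close> has a zero upper right block, because those vectors are eigenvectors of the
  adjoint too. An eigenvector of the lower right block, padded with zeros, is therefore a new
  eigenvector orthogonal to the old ones.\<close>

lemma normal_orthonormal_eigenvectors: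
  fixes A :: "complex mat"
  assumes A: "normal_mat n A" and "k \<le> n"
  shows "\<exists>u a. (\<forall>i<k. \<forall>j<k. (\<Sum>l<n. cnj (u i l) * u j l) = (if i = j then 1 else 0)) \<and>
    (\<forall>j<k. \<forall>i<n. (\<Sum>l<n. A $$ (i,l) * u j l) = a j * u j i)"
  using \<open>k \<le> n\<close>
proof (induction k)
  case 0
  then show ?case by auto
next
  case (Suc k)
  then obtain u0 a where
      u0: "\<forall>i<k. \<forall>j<k. (\<Sum>l<n. cnj (u0 i l) * u0 j l) = (if i = j then 1 else 0)"
    and ev0: "\<forall>j<k. \<forall>i<n. (\<Sum>l<n. A $$ (i,l) * u0 j l) = a j * u0 j i" by auto
  have Ac: "A \<in> carrier_mat n n" using A by (simp add: normal_mat_def)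
  obtain u where uu0: "\<forall>i<k. u i = u0 i"
    and u: "\<And>i j. i < n \<Longrightarrow> j < n \<Longrightarrow> (\<Sum>l<n. cnj (u i l) * u j l) = (if i = j then 1 else 0)"
    using orthonormal_extend[of k n n u0] u0 Suc.prems by auto
  have ev: "(\<Sum>l<n. A $$ (i,l) * u j l) = a j * u j i" if "j < k" "i < n" for i j
    using ev0 uu0 that by simp
  define U where "U = mat n n (\<lambda>(l,i). u i l)"
  have U: "unitary_mat n U" unfolding U_def by (rule unitary_of_orthonormal) (rule u)
  note Ud = unitary_dim[OF U]
  define B where "B = mat_adjoint U * (A * U)"
  have Bc: "B \<in> carrier_mat n n" using Ud(1) Ac by (auto simp: B_def)
  have B0: "B $$ (i,j) = 0" if "i < k" "k \<le> j" "j < n" for i j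
  proof -
    have i: "i < n" using that Suc.prems by simp
    have "B $$ (i,j) = (\<Sum>l<n. cnj (u i l) * (A * U) $$ (l,j))"
      unfolding B_def using that Suc.prems Ud Ac
      by (subst mult_index[of _ n n _ n]) (auto simp: U_def)
    also have "\<dots> = (\<Sum>l<n. \<Sum>m<n. cnj (u i l) * (A $$ (l,m) * u j m))"
      using that Ac Ud by (intro sum.cong refl, subst mult_index[of _ n n _ n])
        (auto simp: U_def sum_distrib_left)
    also have "\<dots> = (\<Sum>m<n. \<Sum>l<n. cnj (u i l) * (A $$ (l,m) * u j m))" by (rule sum.swap)
    also have "\<dots> = (\<Sum>m<n. cnj (\<Sum>l<n. mat_adjoint A $$ (m,l) * u i l) * u j m)"
      using Ac by (intro sum.cong refl) (simp add: sum_distrib_left mult_ac)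
    also have "\<dots> = (\<Sum>m<n. a i * (cnj (u i m) * u j m))"
    proof (intro sum.cong refl)
      fix m assume "m \<in> {..<n}"
      then show "cnj (\<Sum>l<n. mat_adjoint A $$ (m,l) * u i l) * u j m = a i * (cnj (u i m) * u j m)"
        using normal_eigenvector_adjoint[OF A ev[OF \<open>i < k\<close>], of m] by simp
    qed
    also have "\<dots> = 0" using u[OF i \<open>j < n\<close>] that by (simp flip: sum_distrib_left)
    finally show ?thesis .
  qed
  define B' where "B' = mat (n - k) (n - k) (\<lambda>(i,j). B $$ (i + k, j + k))"
  obtain w b where w: "\<exists>l<n-k. w l \<noteq> 0"
    "\<And>i. i < n-k \<Longrightarrow> (\<Sum>l<n-k. B' $$ (i,l) * w l) = b * w i"
    using complex_eigenvector_exists[of B' "n - k"] Suc.prems by (auto simp: B'_def)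
  define y where "y i = (if i < k then 0 else w (i - k))" for i
  have ne: "\<exists>l<n. y l \<noteq> 0"
  proof -
    obtain l where "l < n - k" "w l \<noteq> 0" using w(1) by auto
    then show ?thesis by (intro exI[of _ "l + k"]) (auto simp: y_def)
  qed
  obtain c where c: "c \<noteq> 0" "(\<Sum>l<n. cnj (c * y l) * (c * y l)) = 1"
    using unit_scaling[OF ne] by auto
  have shift: "(\<Sum>l<n. g l) = (\<Sum>l<k. g l) + (\<Sum>l<n-k. g (l + k))" for g :: "nat \<Rightarrow> complex"
  proof -
    have "(\<Sum>l<n. g l) = (\<Sum>l<k. g l) + (\<Sum>l=k..<n. g l)"
      using Suc.prems by (metis Suc_leD atLeast0LessThan le0 sum.atLeastLessThan_concat)
    also have "(\<Sum>l=k..<n. g l) = (\<Sum>l<n-k. g (l + k))"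
      using sum.shift_bounds_nat_ivl[of g 0 k "n - k"] Suc.prems by (simp add: atLeast0LessThan)
    finally show ?thesis .
  qed
  have By: "(\<Sum>l<n. B $$ (i,l) * y l) = b * y i" if "i < n" for i
  proof (cases "i < k")
    case True
    then have "(\<Sum>l<n. B $$ (i,l) * y l) = 0"
      using B0 by (intro sum.neutral) (auto simp: y_def)
    then show ?thesis using True by (simp add: y_def)
  next
    case False
    have "(\<Sum>l<n. B $$ (i,l) * y l) = (\<Sum>l<n-k. B $$ (i,l+k) * w l)"
      unfolding shift by (simp add: y_def)
    also have "\<dots> = (\<Sum>l<n-k. B' $$ (i-k,l) * w l)"
      using False that by (intro sum.cong refl) (auto simp: B'_def)
    also have "\<dots> = b * y i" using w(2)[of "i - k"] False that by (simp add: y_def)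
    finally show ?thesis .
  qed
  define yv where "yv = vec n (\<lambda>l. c * y l)"
  define x where "x = U *\<^sub>v yv"
  have yv: "yv \<in> carrier_vec n" by (simp add: yv_def)
  have x: "x \<in> carrier_vec n" using Ud by (intro carrier_vecI) (simp add: x_def)
  have "B *\<^sub>v yv = b \<cdot>\<^sub>v yv"
  proof (rule eq_vecI)
    fix i assume "i < dim_vec (b \<cdot>\<^sub>v yv)"
    then have i: "i < n" by (simp add: yv_def)
    have "(B *\<^sub>v yv) $ i = (\<Sum>l<n. B $$ (i,l) * (c * y l))"
      using mult_vec_index[OF Bc yv i] by (simp add: yv_def)
    also have "\<dots> = c * (b * y i)"
      using By[OF i, symmetric] by (simp add: sum_distrib_left mult_ac)
    finally show "(B *\<^sub>v yv) $ i = (b \<cdot>\<^sub>v yv) $ i" using i by (simp add: yv_def)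
  qed (use Bc yv in auto)
  moreover have "U *\<^sub>v (B *\<^sub>v yv) = A *\<^sub>v x"
  proof -
    have "U *\<^sub>v (B *\<^sub>v yv) = (U * B) *\<^sub>v yv"
      using Ud Bc yv by (intro assoc_mult_mat_vec[symmetric]) auto
    also have "U * B = A * U"
      unfolding B_def by (rule unitary_cancel(4)[OF U]) (use Ac in auto)
    also have "(A * U) *\<^sub>v yv = A *\<^sub>v x"
      unfolding x_def using Ud Ac yv by (intro assoc_mult_mat_vec) auto
    finally show ?thesis .
  qed
  ultimately have Ax: "A *\<^sub>v x = b \<cdot>\<^sub>v x"
    unfolding x_def using Ud yv by (metis mult_mat_vec)
  have xe: "x $ l = (\<Sum>i<n. u i l * (c * y i))" if "l < n" for l
    using mult_vec_index[OF Ud(1) yv that] that by (simp add: x_def U_def yv_def)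
  have ux: "(\<Sum>l<n. cnj (u i l) * x $ l) = c * y i" if "i < n" for i
  proof -
    have "(\<Sum>l<n. cnj (u i l) * x $ l) = (\<Sum>l<n. \<Sum>m<n. cnj (u i l) * (u m l * (c * y m)))"
      by (simp add: xe sum_distrib_left)
    also have "\<dots> = (\<Sum>m<n. \<Sum>l<n. cnj (u i l) * (u m l * (c * y m)))" by (rule sum.swap)
    also have "\<dots> = (\<Sum>m<n. (\<Sum>l<n. cnj (u i l) * u m l) * (c * y m))"
      by (simp add: sum_distrib_left mult_ac)
    also have "\<dots> = (\<Sum>m<n. (if i = m then c * y m else 0))"
      using u[OF that] by (intro sum.cong refl) auto
    finally show ?thesis using that by simp
  qed
  have xx: "(\<Sum>l<n. cnj (x $ l) * x $ l) = 1"
  proof -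
    have "(\<Sum>l<n. cnj (x $ l) * x $ l) = (\<Sum>l<n. \<Sum>i<n. cnj (u i l) * cnj (c * y i) * x $ l)"
      by (intro sum.cong refl) (simp add: xe sum_distrib_right)
    also have "\<dots> = (\<Sum>i<n. \<Sum>l<n. cnj (u i l) * cnj (c * y i) * x $ l)" by (rule sum.swap)
    also have "\<dots> = (\<Sum>i<n. cnj (c * y i) * (\<Sum>l<n. cnj (u i l) * x $ l))"
      by (simp add: sum_distrib_left mult_ac)
    also have "\<dots> = (\<Sum>i<n. cnj (c * y i) * (c * y i))" by (simp add: ux)
    finally show ?thesis using c(2) by simp
  qed
  have ux0: "(\<Sum>l<n. cnj (u i l) * x $ l) = 0" if "i < k" for i
    using ux[of i] that Suc.prems by (simp add: y_def)
  have xu0: "(\<Sum>l<n. cnj (x $ l) * u i l) = 0" if "i < k" for i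
  proof -
    have "(\<Sum>l<n. cnj (x $ l) * u i l) = cnj (\<Sum>l<n. cnj (u i l) * x $ l)"
      by (simp add: mult.commute)
    then show ?thesis using ux0[OF that] by simp
  qed
  define u' where "u' = u(k := \<lambda>l. x $ l)"
  define a' where "a' = a(k := b)"
  have "(\<Sum>l<n. cnj (u' i l) * u' j l) = (if i = j then 1 else 0)" if "i < Suc k" "j < Suc k" for i j
  proof (cases "i = k"; cases "j = k")
    assume "i = k" "j = k" then show ?thesis using xx by (simp add: u'_def)
  next
    assume "i = k" "j \<noteq> k" then show ?thesis using xu0[of j] that by (simp add: u'_def)
  next
    assume "i \<noteq> k" "j = k" then show ?thesis using ux0[of i] that by (simp add: u'_def)
  next
    assume "i \<noteq> k" "j \<noteq> k" then show ?thesis using u[of i j] that Suc.prems by (simp add: u'_def)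
  qed
  moreover have "(\<Sum>l<n. A $$ (i,l) * u' j l) = a' j * u' j i" if "j < Suc k" "i < n" for i j
  proof (cases "j = k")
    case True
    then show ?thesis
      using mult_vec_index[OF Ac x \<open>i < n\<close>] Ax x that by (simp add: u'_def a'_def)
  next
    case False
    then show ?thesis using ev[of j i] that by (simp add: u'_def a'_def)
  qed
  ultimately show ?case by blast
qed

theorem normal_spectral:
  fixes A :: "complex mat"
  assumes A: "normal_mat n A"
  obtains U a where "unitary_mat n U" "A = U * mat_diag n a * mat_adjoint U"
proof -
  have Ac: "A \<in> carrier_mat n n" using A by (simp add: normal_mat_def)
  obtain u a where u: "\<And>i j. i < n \<Longrightarrow> j < n \<Longrightarrow> (\<Sum>l<n. cnj (u i l) * u j l) = (if i = j then 1 else 0)"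
    and ev: "\<And>i j. j < n \<Longrightarrow> i < n \<Longrightarrow> (\<Sum>l<n. A $$ (i,l) * u j l) = a j * u j i"
    using normal_orthonormal_eigenvectors[OF A order.refl] by blast
  define U where "U = mat n n (\<lambda>(l,i). u i l)"
  have U: "unitary_mat n U" unfolding U_def by (rule unitary_of_orthonormal) (rule u)
  note Ud = unitary_dim[OF U]
  have AU: "A * U = U * mat_diag n a"
  proof (rule eq_matI)
    fix i j assume "i < dim_row (U * mat_diag n a)" "j < dim_col (U * mat_diag n a)"
    then have ij: "i < n" "j < n" using Ud by auto
    have "(A * U) $$ (i,j) = a j * u j i"
      using ij ev by (subst mult_index[OF Ac Ud(1)]) (auto simp: U_def)
    also have "\<dots> = (U * mat_diag n a) $$ (i,j)"
      using ij by (subst mat_diag_mult_right[OF Ud(1)]) (simp add: U_def)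
    finally show "(A * U) $$ (i,j) = (U * mat_diag n a) $$ (i,j)" .
  qed (use Ac Ud in auto)
  have "A = A * (U * mat_adjoint U)" using unitary_cancel(2)[OF U] Ac by simp
  also have "\<dots> = A * U * mat_adjoint U" using Ac Ud by (simp add: mult_assoc_dim)
  finally show ?thesis using that U AU by simp
qed

section \<open>Singular values and functional calculus\<close>

lemma sorting_permutation:
  fixes d :: "nat \<Rightarrow> real"
  shows "\<exists>p. bij_betw p {..<n} {..<n} \<and> (\<forall>i j. i \<le> j \<longrightarrow> j < n \<longrightarrow> d (p j) \<le> d (p i))"
proof -
  define xs where "xs = sort_key (\<lambda>i. - d i) [0..<n]"
  have len: "length xs = n" and dist: "distinct xs" and set: "set xs = {..<n}"
    unfolding xs_def by (simp_all add: atLeast0LessThan)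
  have "bij_betw ((!) xs) {..<n} {..<n}"
    by (rule bij_betw_nth[OF dist]) (simp_all only: len set)
  moreover have "d (xs ! j) \<le> d (xs ! i)" if "i \<le> j" "j < n" for i j
  proof -
    have "sorted (map (\<lambda>i. - d i) xs)" unfolding xs_def by (rule sorted_sort_key)
    from sorted_nth_mono[OF this \<open>i \<le> j\<close>] show ?thesis using that by (simp add: len)
  qed
  ultimately show ?thesis by blast
qed

text \<open>The eigenvalues are real because the diagonal factor is again self-adjoint; permuting
  the columns of the unitary sorts them.\<close>

theorem hermitian_spectral_sorted:
  fixes H :: "complex mat"
  assumes Hc: "H \<in> carrier_mat n n" and H: "mat_adjoint H = H"
  obtains U d where "unitary_mat n U" "H = U * mat_diag n (\<lambda>i. complex_of_real (d i)) * mat_adjoint U"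
    "\<And>i j. i \<le> j \<Longrightarrow> j < n \<Longrightarrow> d j \<le> d i"
proof -
  have "normal_mat n H" using assms by (simp add: normal_mat_def)
  then obtain W a where W: "unitary_mat n W" and HW: "H = W * mat_diag n a * mat_adjoint W"
    by (rule normal_spectral)
  note Wd = unitary_dim[OF W]
  have D: "mat_diag n a = mat_adjoint W * H * W"
    unfolding HW using Wd unitary_cancel[OF W] by (simp add: mult_assoc_dim)
  then have "mat_adjoint (mat_diag n a) = mat_adjoint (mat_adjoint W * H * W)" by simp
  also have "\<dots> = mat_diag n a" using D Wd Hc H by (simp add: adjoint_mult mult_assoc_dim)
  finally have D': "mat_diag n (\<lambda>i. cnj (a i)) = mat_diag n a" by simp
  have a: "complex_of_real (Re (a i)) = a i" if "i < n" for i
    using arg_cong[OF D', of "\<lambda>M. M $$ (i,i)"] that by (simp add: complex_eq_iff)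
  obtain p where p: "bij_betw p {..<n} {..<n}" "\<And>i j. i \<le> j \<Longrightarrow> j < n \<Longrightarrow> Re (a (p j)) \<le> Re (a (p i))"
    using sorting_permutation[of n "\<lambda>i. Re (a i)"] by blast
  have pn: "p i < n" if "i < n" for i using p(1) that by (auto simp: bij_betw_def)
  have pinj: "p i = p j \<longleftrightarrow> i = j" if "i < n" "j < n" for i j
    using p(1) that by (auto simp: bij_betw_def inj_on_def)
  define U where "U = mat n n (\<lambda>(l,i). W $$ (l,p i))"
  define d where "d i = Re (a (p i))" for i
  have Uc: "U \<in> carrier_mat n n" by (simp add: U_def)
  have U: "unitary_mat n U"
    unfolding U_def using unitary_orthonormal[OF W] pn pinj
    by (intro unitary_of_orthonormal) auto
  have "U * mat_diag n (\<lambda>i. complex_of_real (d i)) * mat_adjoint U = W * mat_diag n a * mat_adjoint W"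
  proof (rule eq_matI)
    fix i j assume "i < dim_row (W * mat_diag n a * mat_adjoint W)" "j < dim_col (W * mat_diag n a * mat_adjoint W)"
    then have ij: "i < n" "j < n" using Wd by auto
    have "(U * mat_diag n (\<lambda>i. complex_of_real (d i)) * mat_adjoint U) $$ (i,j)
      = (\<Sum>l<n. U $$ (i,l) * d l * cnj (U $$ (j,l)))"
      using ij Uc by (subst mult_index[of _ n n _ n]) (auto simp: mat_diag_mult_right[OF Uc])
    also have "\<dots> = (\<Sum>l<n. W $$ (i,p l) * a (p l) * cnj (W $$ (j,p l)))"
      using ij a pn by (intro sum.cong refl) (simp add: U_def d_def)
    also have "\<dots> = (\<Sum>l<n. W $$ (i,l) * a l * cnj (W $$ (j,l)))"
      by (rule sum.reindex_bij_betw[OF p(1)])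
    also have "\<dots> = (W * mat_diag n a * mat_adjoint W) $$ (i,j)"
      using ij Wd(2,3) by (subst mult_index[of _ n n _ n]) (auto simp: mat_diag_mult_right[OF Wd(1)])
    finally show "(U * mat_diag n (\<lambda>i. complex_of_real (d i)) * mat_adjoint U) $$ (i,j) =
      (W * mat_diag n a * mat_adjoint W) $$ (i,j)" .
  qed (use Uc Wd in auto)
  then show ?thesis using that[OF U, of d] HW p(2) by (simp add: d_def)
qed

lemma gram_index:
  fixes Y :: "complex mat"
  assumes "Y \<in> carrier_mat n m" "i < m" "j < m"
  shows "(mat_adjoint Y * Y) $$ (i,j) = (\<Sum>l<n. cnj (Y $$ (l,i)) * Y $$ (l,j))"
  using assms by (subst mult_index[of _ m n _ m]) auto

lemma gram_index_diag:
  fixes Y :: "complex mat"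
  assumes "Y \<in> carrier_mat n m" "i < m"
  shows "(mat_adjoint Y * Y) $$ (i,i) = complex_of_real (\<Sum>l<n. (cmod (Y $$ (l,i)))\<^sup>2)"
  unfolding gram_index[OF assms(1,2,2)] of_real_sum
  by (intro sum.cong refl) (subst complex_norm_square, simp add: mult.commute)

text \<open>With \<open>V\<close> diagonalising \<open>Y\<^sup>* Y\<close>, the columns of
  \<open>Y V\<close> are orthogonal with squared lengths \<open>d\<close>. The nonzero ones,
  normalised, are completed to \<open>U\<close>.\<close>

theorem singular_value_decomposition:
  fixes Y :: "complex mat"
  assumes Yc: "Y \<in> carrier_mat n n"
  obtains U s V where "unitary_mat n U" "unitary_mat n V"
    "Y = U * mat_diag n (\<lambda>i. complex_of_real (s i)) * mat_adjoint V"
    "\<And>i. i < n \<Longrightarrow> 0 \<le> s i" "\<And>i j. i \<le> j \<Longrightarrow> j < n \<Longrightarrow> s j \<le> s i"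
proof -
  have "mat_adjoint Y * Y \<in> carrier_mat n n" "mat_adjoint (mat_adjoint Y * Y) = mat_adjoint Y * Y"
    using Yc by (auto simp: adjoint_mult)
  then obtain V d where V: "unitary_mat n V"
    and YV: "mat_adjoint Y * Y = V * mat_diag n (\<lambda>i. complex_of_real (d i)) * mat_adjoint V"
    and d: "\<And>i j. i \<le> j \<Longrightarrow> j < n \<Longrightarrow> d j \<le> d i"
    using hermitian_spectral_sorted by blast
  note Vd = unitary_dim[OF V]
  define T where "T = Y * V"
  have Tc: "T \<in> carrier_mat n n" using Yc Vd(1) by (auto simp: T_def)
  have "mat_adjoint T * T = mat_adjoint V * (mat_adjoint Y * Y) * V"
    using Yc Vd by (simp add: T_def adjoint_mult mult_assoc_dim)
  also have "\<dots> = mat_diag n (\<lambda>i. complex_of_real (d i))"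
    unfolding YV using Vd unitary_cancel[OF V] by (simp add: mult_assoc_dim)
  finally have TT: "mat_adjoint T * T = mat_diag n (\<lambda>i. complex_of_real (d i))" .
  have Tij: "(\<Sum>l<n. cnj (T $$ (l,i)) * T $$ (l,j)) = (if i = j then complex_of_real (d i) else 0)"
    if "i < n" "j < n" for i j
    using gram_index[OF Tc that] TT that by simp
  have dn: "d i = (\<Sum>l<n. (cmod (T $$ (l,i)))\<^sup>2)" if "i < n" for i
    using gram_index_diag[OF Tc that] TT that
    by (metis mat_diag_index of_real_eq_iff)
  have d0: "0 \<le> d i" if "i < n" for i using dn[OF that] by (simp add: sum_nonneg)
  \<comment> \<open>Sorting puts the nonzero columns first, so they occupy the indices below
    \<open>r\<close> and \<open>orthonormal_extend\<close> applies.\<close>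
  define r where "r = card {i. i < n \<and> 0 < d i}"
  have rn: "r \<le> n"
    unfolding r_def using card_mono[of "{..<n}" "{i. i < n \<and> 0 < d i}"] by auto
  have r: "0 < d i \<longleftrightarrow> i < r" if "i < n" for i
  proof
    assume "0 < d i"
    then have "{..i} \<subseteq> {i. i < n \<and> 0 < d i}"
      using that d by (auto intro: order_less_le_trans)
    from card_mono[OF _ this] show "i < r" by (simp add: r_def)
  next
    assume "i < r"
    show "0 < d i"
    proof (rule ccontr)
      assume "\<not> 0 < d i"
      then have "{j. j < n \<and> 0 < d j} \<subseteq> {..<i}"
        using d by (auto simp: not_less) (meson leD le_less_linear order_trans)
      from card_mono[OF _ this] show False using \<open>i < r\<close> by (simp add: r_def)
    qed
  qed
  define u0 where "u0 i l = T $$ (l,i) / complex_of_real (sqrt (d i))" for i l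
  have "(\<Sum>l<n. cnj (u0 i l) * u0 j l) = (if i = j then 1 else 0)" if "i < r" "j < r" for i j
  proof -
    have ij: "i < n" "j < n" "0 < d i" "0 < d j" using that rn r by auto
    have "(\<Sum>l<n. cnj (u0 i l) * u0 j l) =
      (\<Sum>l<n. cnj (T $$ (l,i)) * T $$ (l,j)) / complex_of_real (sqrt (d i) * sqrt (d j))"
      by (simp add: u0_def sum_divide_distrib)
    also have "\<dots> = (if i = j then 1 else 0)"
      using ij by (cases "i = j") (simp_all add: Tij flip: of_real_mult)
    finally show ?thesis .
  qed
  then obtain u where u: "\<forall>i<r. u i = u0 i"
    "\<And>i j. i < n \<Longrightarrow> j < n \<Longrightarrow> (\<Sum>l<n. cnj (u i l) * u j l) = (if i = j then 1 else 0)"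
    using orthonormal_extend[OF rn order.refl, of u0] by blast
  define U where "U = mat n n (\<lambda>(l,i). u i l)"
  define s where "s i = sqrt (d i)" for i
  have U: "unitary_mat n U" unfolding U_def by (rule unitary_of_orthonormal) (rule u)
  note Ud = unitary_dim[OF U]
  have T: "T = U * mat_diag n (\<lambda>i. complex_of_real (s i))"
  proof (rule eq_matI)
    fix i j assume "i < dim_row (U * mat_diag n (\<lambda>i. complex_of_real (s i)))"
      "j < dim_col (U * mat_diag n (\<lambda>i. complex_of_real (s i)))"
    then have ij: "i < n" "j < n" using Ud by auto
    have "T $$ (i,j) = u j i * s j"
    proof (cases "j < r")
      case True
      then have "0 < d j" using r ij by simp
      then show ?thesis using u(1) True by (simp add: u0_def s_def)
    next
      case False
      then have 0: "d j = 0" using r d0 ij by force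
      then have "(\<Sum>l<n. (cmod (T $$ (l,j)))\<^sup>2) = 0" using dn ij by simp
      then have "T $$ (i,j) = 0" using ij by (subst (asm) sum_nonneg_eq_0_iff) auto
      then show ?thesis using 0 by (simp add: s_def)
    qed
    then show "T $$ (i,j) = (U * mat_diag n (\<lambda>i. complex_of_real (s i))) $$ (i,j)"
      using ij by (subst mat_diag_mult_right[OF Ud(1)]) (simp add: U_def)
  qed (use Tc Ud in auto)
  have "Y = T * mat_adjoint V"
    using Yc Vd unitary_cancel[OF V] by (simp add: T_def mult_assoc_dim)
  then show ?thesis using that[OF U V, of s] T d d0 by (simp add: s_def)
qed

text \<open>Independence of the choice in \<open>mat_fun\<close>: for two decompositions,
  \<open>M = V\<^sup>* U\<close> intertwines the diagonals, so each nonzero entry of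
  \<open>M\<close> sits where the eigenvalues agree, and \<open>M\<close> intertwines their images
  under \<open>f\<close> as well.\<close>

lemma mat_fun_unitary_diag:
  assumes U: "unitary_mat n U"
  shows "mat_fun n f (U * mat_diag n (\<lambda>i. complex_of_real (d i)) * mat_adjoint U) =
    U * mat_diag n (\<lambda>i. complex_of_real (f (d i))) * mat_adjoint U"
proof -
  note Ud = unitary_dim[OF U]
  let ?D = "mat_diag n (\<lambda>i. complex_of_real (d i))"
  let ?fD = "mat_diag n (\<lambda>i. complex_of_real (f (d i)))"
  let ?P = "\<lambda>B. \<exists>V D. unitary_mat n V \<and> real_diag_mat n D \<and>
      U * ?D * mat_adjoint U = V * D * mat_adjoint V \<and> B = V * diag_apply n f D * mat_adjoint V"
  have "?P (U * ?fD * mat_adjoint U)"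
  proof (intro exI conjI)
    show "real_diag_mat n ?D" by (auto simp: real_diag_mat_def diagonal_mat_def)
    show "U * ?fD * mat_adjoint U = U * diag_apply n f ?D * mat_adjoint U"
    proof -
      have "?fD = diag_apply n f ?D" by (rule eq_matI) (auto simp: diag_apply_def)
      then show ?thesis by simp
    qed
  qed (use U in auto)
  moreover have "B = U * ?fD * mat_adjoint U" if PB: "?P B" for B
  proof -
    obtain V D where V: "unitary_mat n V" and D: "real_diag_mat n D"
      and eq: "U * ?D * mat_adjoint U = V * D * mat_adjoint V"
      and B: "B = V * diag_apply n f D * mat_adjoint V" using PB by blast
    note Vd = unitary_dim[OF V]
    define e where "e i = Re (D $$ (i,i))" for i
    have Ddim: "dim_row D = n" "dim_col D = n" and D0: "\<And>i j. i < n \<Longrightarrow> j < n \<Longrightarrow> i \<noteq> j \<Longrightarrow> D $$ (i,j) = 0"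
      and Dr: "\<And>i. i < n \<Longrightarrow> D $$ (i,i) \<in> \<real>"
      using D by (auto simp: real_diag_mat_def diagonal_mat_def)
    have De: "D = mat_diag n (\<lambda>i. complex_of_real (e i))"
      using D0 Dr by (intro eq_matI) (auto simp: Ddim e_def)
    have fDe: "diag_apply n f D = mat_diag n (\<lambda>i. complex_of_real (f (e i)))"
      by (rule eq_matI) (auto simp: diag_apply_def e_def)
    define M where "M = mat_adjoint V * U"
    have Mc: "M \<in> carrier_mat n n" using Ud(1) Vd(1) by (auto simp: M_def)
    have "M * ?D = mat_adjoint V * (U * ?D * mat_adjoint U) * U"
      using Ud Vd unitary_cancel[OF U] by (simp add: M_def mult_assoc_dim)
    also have "\<dots> = D * M"
      unfolding eq using Ud Vd Ddim unitary_cancel[OF V] by (simp add: M_def mult_assoc_dim)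
    finally have MD: "M * ?D = mat_diag n (\<lambda>i. complex_of_real (e i)) * M" by (simp add: De)
    have Mij: "M $$ (i,j) * d j = e i * M $$ (i,j)" if "i < n" "j < n" for i j
      using arg_cong[OF MD, of "\<lambda>M. M $$ (i,j)"] that
      unfolding mat_diag_mult_right[OF Mc] mat_diag_mult_left[OF Mc] by simp
    have MfD: "M * ?fD = diag_apply n f D * M"
      unfolding fDe mat_diag_mult_right[OF Mc] mat_diag_mult_left[OF Mc]
    proof (rule eq_matI)
      fix i j assume "i < dim_row (mat n n (\<lambda>(i,j). complex_of_real (f (e i)) * M $$ (i,j)))"
        "j < dim_col (mat n n (\<lambda>(i,j). complex_of_real (f (e i)) * M $$ (i,j)))"
      then have ij: "i < n" "j < n" by auto
      have "M $$ (i,j) = 0 \<or> d j = e i"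
        using Mij[OF ij] by (metis mult.commute mult_cancel_left of_real_eq_iff)
      then show "mat n n (\<lambda>(i,j). M $$ (i,j) * complex_of_real (f (d j))) $$ (i,j) =
        mat n n (\<lambda>(i,j). complex_of_real (f (e i)) * M $$ (i,j)) $$ (i,j)" using ij by auto
    qed auto
    have "U * ?fD * mat_adjoint U = V * (M * ?fD) * mat_adjoint U"
      using Ud Vd unitary_cancel[OF V] by (simp add: M_def mult_assoc_dim)
    also have "\<dots> = B"
      unfolding MfD B using Ud Vd unitary_cancel[OF U] by (simp add: M_def mult_assoc_dim fDe)
    finally show ?thesis by simp
  qed
  ultimately show ?thesis unfolding mat_fun_def by (rule some_equality)
qed

text \<open>The middle factor may be complex, so this covers a diagonalised normal matrix, with
  \<open>U = V\<close>, as well as a singular value decomposition.\<close>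

lemma mat_abs_svd:
  assumes U: "unitary_mat n U" and V: "unitary_mat n V"
  shows "mat_abs n (U * mat_diag n a * mat_adjoint V) =
    V * mat_diag n (\<lambda>i. complex_of_real (cmod (a i))) * mat_adjoint V"
proof -
  note Ud = unitary_dim[OF U] and Vd = unitary_dim[OF V]
  let ?X = "U * mat_diag n a * mat_adjoint V"
  have "mat_adjoint ?X * ?X = V * (mat_diag n (\<lambda>i. cnj (a i)) * mat_diag n a) * mat_adjoint V"
    using Ud Vd unitary_cancel[OF U] by (simp add: adjoint_mult mult_assoc_dim del: mat_diag_diag)
  also have "mat_diag n (\<lambda>i. cnj (a i)) * mat_diag n a = mat_diag n (\<lambda>i. complex_of_real ((cmod (a i))\<^sup>2))"
    unfolding mat_diag_diag by (rule mat_diag_cong) (subst complex_norm_square, simp add: mult.commute)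
  finally show ?thesis
    unfolding mat_abs_def by (simp only: mat_fun_unitary_diag[OF V] real_sqrt_abs abs_norm_cancel)
qed

section \<open>Concave functions and partial sums\<close>

text \<open>A strict decrease would persist by concavity and drive \<open>f\<close> below 0 far to
  the right.\<close>

lemma concave_nonneg_mono:
  fixes f :: "real \<Rightarrow> real"
  assumes conc: "concave_on {0..} f" and nn: "\<forall>x\<ge>0. f x \<ge> 0" and "0 \<le> x" "x \<le> y"
  shows "f x \<le> f y"
proof (rule ccontr)
  assume less: "\<not> f x \<le> f y"
  then have "x \<noteq> y" by auto
  then have xy: "x < y" using \<open>x \<le> y\<close> by simp
  have "0 \<le> f y" using nn xy \<open>0 \<le> x\<close> by simp
  then have fx: "f x > 0" "f y < f x" "0 \<le> f y" using less by simp_all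
  \<comment> \<open>Half of the relative drop: \<open>(1 - t) * f x\<close> is then the mean of
    \<open>f x\<close> and \<open>f y\<close>, still above \<open>f y\<close>, while
    \<open>z\<close> is placed so that \<open>y = (1 - t) * x + t * z\<close>.\<close>
  define t where "t = (f x - f y) / (2 * f x)"
  have t: "0 < t" "t < 1" using fx by (auto simp: t_def field_simps)
  define z where "z = x + (y - x) / t"
  have z: "0 \<le> z" using t xy \<open>0 \<le> x\<close> by (simp add: z_def)
  have "f ((1 - t) *\<^sub>R x + t *\<^sub>R z) \<ge> (1 - t) * f x + t * f z"
    using conc t z \<open>0 \<le> x\<close> by (intro concave_onD[of "{0..}" f]) auto
  moreover have "(1 - t) *\<^sub>R x + t *\<^sub>R z = y" using t by (simp add: z_def field_simps)
  moreover have "t * f z \<ge> 0" using nn z t by simp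
  ultimately have "(1 - t) * f x \<le> f y" by simp
  moreover have "t * f x = (f x - f y) / 2" using fx by (simp add: t_def)
  ultimately have "f x - (f x - f y) / 2 \<le> f y" by (simp add: left_diff_distrib)
  then show False using fx by (simp add: field_simps)
qed

lemma concave_slopes:
  fixes f :: "real \<Rightarrow> real"
  assumes conc: "concave_on {0..} f" and "0 \<le> s" "s < t" "t < b"
  shows "(f b - f t) / (b - t) * (t - s) \<le> f t - f s"
proof -
  define u where "u = (t - s) / (b - s)"
  have u: "0 \<le> u" "u \<le> 1" using assms by (auto simp: u_def)
  have ub: "u * (b - s) = t - s" using assms by (simp add: u_def)
  have "f ((1 - u) *\<^sub>R s + u *\<^sub>R b) \<ge> (1 - u) * f s + u * f b"
    using assms u by (intro concave_onD[of "{0..}" f]) auto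
  moreover have "(1 - u) *\<^sub>R s + u *\<^sub>R b = t" using ub by (simp add: algebra_simps)
  ultimately have "(1 - u) * f s + u * f b \<le> f t" by simp
  then have "((1 - u) * f s + u * f b) * (b - s) \<le> f t * (b - s)"
    using assms by (intro mult_right_mono) auto
  also have "((1 - u) * f s + u * f b) * (b - s) = (b - s) * f s - (u * (b - s)) * f s + (u * (b - s)) * f b"
    by (simp add: algebra_simps)
  finally have "(b - t) * f s + (t - s) * f b \<le> f t * (b - s)" unfolding ub by (simp add: algebra_simps)
  then have "(f b - f t) * (t - s) \<le> (f t - f s) * (b - t)" by (simp add: algebra_simps)
  then show ?thesis using assms by (simp add: field_simps)
qed

text \<open>Prescribing a final slope \<open>d\<close> is what makes the induction on the largest node go through: passing
  to a new node trades the old slope \<open>d'\<close> for \<open>d\<close> at the cost of a term \<open>(d' - d) * min t b\<close>.\<close>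

lemma concave_min_expansion_slope:
  fixes f :: "real \<Rightarrow> real"
  assumes conc: "concave_on {0..} f" and nn: "\<forall>x\<ge>0. f x \<ge> 0"
    and "finite T" "T \<subseteq> {0<..}" "0 \<le> d"
    and "\<forall>s\<ge>0. s < Max (insert 0 T) \<longrightarrow> d * (Max (insert 0 T) - s) \<le> f (Max (insert 0 T)) - f s"
  shows "\<exists>c g. 0 \<le> c \<and> (\<forall>a. 0 \<le> g a) \<and>
    (\<forall>t\<in>insert 0 T. f t = c + d * t + (\<Sum>a\<in>T. g a * min t a))"
  using assms(3-6)
proof (induction T arbitrary: d rule: finite_linorder_max_induct)
  case empty
  then show ?case using nn by (intro exI[of _ "f 0"]) auto
next
  case (insert b T)
  define \<tau> where "\<tau> = Max (insert 0 T)"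
  have \<tau>: "\<tau> \<in> insert 0 T" unfolding \<tau>_def using insert.hyps by (intro Max_in) auto
  have \<tau>ub: "a \<le> \<tau>" if "a \<in> insert 0 T" for a
    unfolding \<tau>_def using insert.hyps that by (intro Max_ge) auto
  have \<tau>b: "\<tau> < b" "0 \<le> \<tau>" using \<tau> \<tau>ub[of 0] insert.hyps(2) insert.prems(1) by auto
  have mb: "Max (insert 0 (insert b T)) = b"
    using insert.hyps insert.prems(1) by (intro Max_eqI) (auto intro: less_imp_le)
  define d' where "d' = (f b - f \<tau>) / (b - \<tau>)"
  \<comment> \<open>The prescribed slope, tested at \<open>s = \<tau>\<close>, is at most the chord
    slope \<open>d'\<close>, so the new coefficient \<open>d' - d\<close> is nonnegative.\<close>
  have "d * (b - \<tau>) \<le> f b - f \<tau>" using insert.prems(3) \<tau>b by (simp only: mb)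
  then have dd': "d \<le> d'" using \<tau>b by (simp add: d'_def field_simps)
  have fb: "f b = f \<tau> + d' * (b - \<tau>)" using \<tau>b by (simp add: d'_def)
  have "\<forall>s\<ge>0. s < \<tau> \<longrightarrow> d' * (\<tau> - s) \<le> f \<tau> - f s"
    unfolding d'_def using concave_slopes[OF conc _ _ \<tau>b(1)] by blast
  moreover have "T \<subseteq> {0<..}" "0 \<le> d'" using insert.prems dd' by simp_all
  ultimately have "\<exists>c g. 0 \<le> c \<and> (\<forall>a. 0 \<le> g a) \<and>
      (\<forall>t\<in>insert 0 T. f t = c + d' * t + (\<Sum>a\<in>T. g a * min t a))"
    unfolding \<tau>_def by (intro insert.IH)
  then obtain c g where cg: "0 \<le> c" "\<And>a. 0 \<le> g a"
    and eq: "\<And>t. t \<in> insert 0 T \<Longrightarrow> f t = c + d' * t + (\<Sum>a\<in>T. g a * min t a)"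
    by blast
  have bT: "b \<notin> T" using insert.hyps by auto
  define g' where "g' = g(b := d' - d)"
  have g'T: "(\<Sum>a\<in>T. g' a * min t a) = (\<Sum>a\<in>T. g a * min t a)" for t
    using bT by (intro sum.cong refl) (auto simp: g'_def)
  have "f t = c + d * t + (\<Sum>a\<in>insert b T. g' a * min t a)" if "t \<in> insert 0 (insert b T)" for t
  proof (cases "t = b")
    case True
    \<comment> \<open>No node of \<open>T\<close> exceeds \<tau>, so all old terms agree at
      \<open>b\<close> and \<tau>.\<close>
    have "(\<Sum>a\<in>T. g a * min b a) = (\<Sum>a\<in>T. g a * min \<tau> a)"
      using insert.hyps \<tau>ub by (intro sum.cong refl) (auto simp: min_def intro: order.antisym)
    then have "f b = c + d' * b + (\<Sum>a\<in>T. g a * min b a)"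
      using fb eq[OF \<tau>] by (simp add: algebra_simps)
    then show ?thesis unfolding True using bT insert.hyps(1) g'T
      by (simp add: g'_def algebra_simps)
  next
    case False
    then have t: "t \<in> insert 0 T" using that by auto
    then have "t \<le> b" using \<tau>ub \<tau>b by force
    then show ?thesis using bT insert.hyps(1) g'T eq[OF t]
      by (simp add: g'_def min_absorb1 algebra_simps)
  qed
  moreover have "\<forall>a. 0 \<le> g' a" using cg dd' by (simp add: g'_def)
  ultimately show ?case using cg(1) by blast
qed

text \<open>The final slope can be prescribed as 0 because \<open>f\<close> is nondecreasing. A node
  at 0 would contribute \<open>min t 0\<close>, which vanishes on \<open>T\<close>.\<close>

lemma concave_min_expansion:
  fixes f :: "real \<Rightarrow> real"
  assumes conc: "concave_on {0..} f" and nn: "\<forall>x\<ge>0. f x \<ge> 0"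
    and T: "finite T" "T \<subseteq> {0..}"
  obtains c g where "0 \<le> c" "\<And>a. 0 \<le> g a"
    "\<And>t. t \<in> T \<Longrightarrow> f t = c + (\<Sum>a\<in>T - {0}. g a * min t a)"
proof -
  define T' where "T' = T - {0}"
  have T': "finite T'" "T' \<subseteq> {0<..}" using T by (auto simp: T'_def less_le)
  have m: "\<forall>s\<ge>0. s < Max (insert 0 T') \<longrightarrow> 0 * (Max (insert 0 T') - s) \<le> f (Max (insert 0 T')) - f s"
    using concave_nonneg_mono[OF conc nn] by auto
  from concave_min_expansion_slope[OF conc nn T' order.refl m]
  obtain c g where "0 \<le> c" "\<forall>a. 0 \<le> g a"
    "\<forall>t\<in>insert 0 T'. f t = c + 0 * t + (\<Sum>a\<in>T'. g a * min t a)" by blast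
  then show ?thesis using that[of c g] by (auto simp: T'_def)
qed

lemma concave_sum_le_of_min:
  fixes f :: "real \<Rightarrow> real" and m :: "nat \<Rightarrow> nat \<Rightarrow> real"
  assumes conc: "concave_on {0..} f" and nn: "\<forall>x\<ge>0. f x \<ge> 0"
    and lam: "\<And>j. j < k \<Longrightarrow> 0 \<le> lam j" and al: "\<And>i. i < n \<Longrightarrow> 0 \<le> al i"
    and one: "\<And>j. j < k \<Longrightarrow> 1 \<le> (\<Sum>i<n. m i j)"
    and cut: "\<And>a. 0 < a \<Longrightarrow> (\<Sum>j<k. min (lam j) a) \<le> (\<Sum>j<k. \<Sum>i<n. min (al i) a * m i j)"
  shows "(\<Sum>j<k. f (lam j)) \<le> (\<Sum>j<k. \<Sum>i<n. f (al i) * m i j)"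
proof -
  \<comment> \<open>All points at which \<open>f\<close> is evaluated on either side, so that the
    expansion replaces \<open>f\<close> exactly.\<close>
  define T where "T = lam ` {..<k} \<union> al ` {..<n}"
  have T: "finite T" "T \<subseteq> {0..}" using lam al by (auto simp: T_def)
  obtain c g where c: "0 \<le> c" and g: "\<And>a. 0 \<le> g a"
    and eq: "\<And>t. t \<in> T \<Longrightarrow> f t = c + (\<Sum>a\<in>T - {0}. g a * min t a)"
    using concave_min_expansion[OF conc nn T] by blast
  have "(\<Sum>j<k. f (lam j)) = (\<Sum>j<k. c + (\<Sum>a\<in>T - {0}. g a * min (lam j) a))"
    by (intro sum.cong refl eq) (auto simp: T_def)
  also have "\<dots> = c * (\<Sum>j<k. 1) + (\<Sum>a\<in>T - {0}. g a * (\<Sum>j<k. min (lam j) a))"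
    by (simp add: sum.distrib sum_distrib_left) (rule sum.swap)
  also have "\<dots> \<le> c * (\<Sum>j<k. \<Sum>i<n. m i j) +
      (\<Sum>a\<in>T - {0}. g a * (\<Sum>j<k. \<Sum>i<n. min (al i) a * m i j))"
  proof (rule add_mono)
    show "c * (\<Sum>j<k. 1) \<le> c * (\<Sum>j<k. \<Sum>i<n. m i j)"
      by (intro mult_left_mono[OF _ c] sum_mono one) simp
    show "(\<Sum>a\<in>T - {0}. g a * (\<Sum>j<k. min (lam j) a)) \<le>
        (\<Sum>a\<in>T - {0}. g a * (\<Sum>j<k. \<Sum>i<n. min (al i) a * m i j))"
    proof (rule sum_mono)
      fix a assume "a \<in> T - {0}"
      then have "0 < a" using T by auto
      from mult_left_mono[OF cut[OF this] g]
      show "g a * (\<Sum>j<k. min (lam j) a) \<le> g a * (\<Sum>j<k. \<Sum>i<n. min (al i) a * m i j)" .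
    qed
  qed
  also have "\<dots> = (\<Sum>j<k. \<Sum>i<n. (c + (\<Sum>a\<in>T - {0}. g a * min (al i) a)) * m i j)"
  proof -
    have "(\<Sum>a\<in>T - {0}. g a * (\<Sum>j<k. \<Sum>i<n. min (al i) a * m i j)) =
        (\<Sum>a\<in>T - {0}. \<Sum>j<k. \<Sum>i<n. g a * min (al i) a * m i j)"
      by (simp add: sum_distrib_left mult_ac)
    also have "\<dots> = (\<Sum>j<k. \<Sum>a\<in>T - {0}. \<Sum>i<n. g a * min (al i) a * m i j)" by (rule sum.swap)
    also have "\<dots> = (\<Sum>j<k. \<Sum>i<n. \<Sum>a\<in>T - {0}. g a * min (al i) a * m i j)"
      by (intro sum.cong refl) (rule sum.swap)
    finally show ?thesis
      by (simp add: distrib_right sum.distrib sum_distrib_left sum_distrib_right)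
  qed
  also have "\<dots> = (\<Sum>j<k. \<Sum>i<n. f (al i) * m i j)"
    by (intro sum.cong refl arg_cong2[where f="(*)"] eq[symmetric]) (auto simp: T_def)
  finally show ?thesis .
qed

text \<open>The bathtub principle: weights in [0,1] of total mass at most \<open>k\<close> do best
  on the \<open>k\<close> largest values. Relative to the threshold \<open>c\<close>, each
  \<open>(\<gamma> i - c) * (w i - e i)\<close> is nonpositive, and \<open>c \<ge> 0\<close> takes
  care of missing mass.\<close>

lemma weighted_sum_le_initial_sum:
  fixes \<gamma> w :: "nat \<Rightarrow> real"
  assumes anti: "\<And>i j. i \<le> j \<Longrightarrow> j < n \<Longrightarrow> \<gamma> j \<le> \<gamma> i" and nn: "\<And>i. i < n \<Longrightarrow> 0 \<le> \<gamma> i"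
    and w: "\<And>i. i < n \<Longrightarrow> 0 \<le> w i" "\<And>i. i < n \<Longrightarrow> w i \<le> 1"
    and "(\<Sum>i<n. w i) \<le> real k" "k \<le> n"
  shows "(\<Sum>i<n. \<gamma> i * w i) \<le> (\<Sum>i<k. \<gamma> i)"
proof (cases "n = 0")
  case True
  then show ?thesis using assms by simp
next
  case False
  \<comment> \<open>For \<open>k = 0\<close> truncated subtraction gives
    \<open>c = \<gamma> 0\<close>, which still bounds every value from above, as the second case
    below needs.\<close>
  define c where "c = \<gamma> (k - 1)"
  have c: "0 \<le> c" using nn[of "k - 1"] False \<open>k \<le> n\<close> by (simp add: c_def)
  define e where "e i = (if i < k then 1 else 0 :: real)" for i :: nat
  have se: "(\<Sum>i<n. h i * e i) = (\<Sum>i<k. h i)" for h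
  proof -
    have "(\<Sum>i<n. h i * e i) = (\<Sum>i\<in>{..<n} \<inter> {i. i < k}. h i)"
      by (simp add: e_def if_distrib sum.If_cases cong: if_cong)
    also have "{..<n} \<inter> {i. i < k} = {..<k}" using \<open>k \<le> n\<close> by auto
    finally show ?thesis .
  qed
  have "(\<gamma> i - c) * (w i - e i) \<le> 0" if "i < n" for i
  proof (cases "i < k")
    case True
    then have "c \<le> \<gamma> i" unfolding c_def using anti[of i "k - 1"] \<open>k \<le> n\<close> by simp
    then show ?thesis using True w(2)[OF that] by (simp add: e_def mult_nonneg_nonpos)
  next
    case F: False
    then have "\<gamma> i \<le> c" unfolding c_def using anti[of "k - 1" i] that by simp
    then show ?thesis using F w(1)[OF that] by (simp add: e_def mult_nonpos_nonneg)
  qed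
  then have "(\<Sum>i<n. (\<gamma> i - c) * (w i - e i)) \<le> 0" by (intro sum_nonpos) auto
  also have "(\<Sum>i<n. (\<gamma> i - c) * (w i - e i)) =
    (\<Sum>i<n. \<gamma> i * w i) - c * (\<Sum>i<n. w i) - (\<Sum>i<n. \<gamma> i * e i) + c * (\<Sum>i<n. 1 * e i)"
    by (simp add: algebra_simps sum.distrib sum_subtractf sum_distrib_left)
  finally have "(\<Sum>i<n. \<gamma> i * w i) \<le> (\<Sum>i<k. \<gamma> i) + c * ((\<Sum>i<n. w i) - real k)"
    unfolding se by (simp add: algebra_simps)
  also have "c * ((\<Sum>i<n. w i) - real k) \<le> 0" using c assms(5) by (simp add: mult_nonneg_nonpos)
  finally show ?thesis by simp
qed

section \<open>Symmetric norms\<close>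

abbreviation real_diag :: "nat \<Rightarrow> (nat \<Rightarrow> real) \<Rightarrow> complex mat" where
  "real_diag n x \<equiv> mat_diag n (\<lambda>i. complex_of_real (x i))"

lemma symmetric_normD:
  assumes "symmetric_norm n N"
  shows "X \<in> carrier_mat n n \<Longrightarrow> 0 \<le> N X"
    "X \<in> carrier_mat n n \<Longrightarrow> N (c \<cdot>\<^sub>m X) = cmod c * N X"
    "X \<in> carrier_mat n n \<Longrightarrow> Y \<in> carrier_mat n n \<Longrightarrow> N (X + Y) \<le> N X + N Y"
    "X \<in> carrier_mat n n \<Longrightarrow> unitary_mat n U \<Longrightarrow> unitary_mat n V \<Longrightarrow> N (U * X * V) = N X"
  using assms unfolding symmetric_norm_def by blast+

lemma symmetric_norm_left:
  assumes "symmetric_norm n N" "X \<in> carrier_mat n n" "unitary_mat n U"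
  shows "N (U * X) = N X"
proof -
  have "U * X \<in> carrier_mat n n" using assms(2) unitary_dim(1)[OF assms(3)] by auto
  then have "U * X * 1\<^sub>m n = U * X" by (rule right_mult_one_mat)
  then show ?thesis using symmetric_normD(4)[OF assms(1,2,3) unitary_one] by simp
qed

text \<open>The norm estimates below come down to this: the smaller matrix is a convex combination
  of the larger one and a matrix of no greater norm.\<close>

lemma symmetric_norm_convex:
  assumes N: "symmetric_norm n N" and X: "X \<in> carrier_mat n n" and Y: "Y \<in> carrier_mat n n"
    and "N Y \<le> N X" "0 \<le> t" "t \<le> 1"
  shows "N (complex_of_real t \<cdot>\<^sub>m X + complex_of_real (1 - t) \<cdot>\<^sub>m Y) \<le> N X"
proof -
  have "N (complex_of_real t \<cdot>\<^sub>m X + complex_of_real (1 - t) \<cdot>\<^sub>m Y)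
    \<le> N (complex_of_real t \<cdot>\<^sub>m X) + N (complex_of_real (1 - t) \<cdot>\<^sub>m Y)"
    using X Y by (intro symmetric_normD(3)[OF N]) auto
  also have "\<dots> = t * N X + (1 - t) * N Y"
    using assms by (simp add: symmetric_normD(2)[OF N] del: of_real_diff)
  also have "\<dots> \<le> t * N X + (1 - t) * N X" using assms by (intro add_mono mult_left_mono) auto
  finally show ?thesis by (simp add: algebra_simps)
qed

text \<open>Averaging with the conjugate under the reflection \<open>E\<close> of coordinate
  \<open>k\<close> removes the off-diagonal entries of row and column \<open>k\<close>; this is done
  for one coordinate after the other.\<close>

lemma symmetric_norm_pinching:
  assumes N: "symmetric_norm n N" and M: "M \<in> carrier_mat n n"
  shows "N (mat_diag n (\<lambda>i. M $$ (i,i))) \<le> N M"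
proof -
  define P where "P k = mat n n (\<lambda>(i,j). if i \<noteq> j \<and> (i < k \<or> j < k) then 0 else M $$ (i,j))" for k
  have Pc: "P k \<in> carrier_mat n n" for k by (simp add: P_def)
  have "N (P k) \<le> N M" if "k \<le> n" for k
    using that
  proof (induction k)
    case 0
    have "P 0 = M" using M by (intro eq_matI) (auto simp: P_def)
    then show ?case by simp
  next
    case (Suc k)
    define E where "E = mat_diag n (\<lambda>i. if i = k then -1 else 1 :: complex)"
    have E: "unitary_mat n E" unfolding E_def by (rule unitary_mat_diag) auto
    have Ec: "E \<in> carrier_mat n n" by (simp add: E_def)
    have EP: "E * P k * E = mat n n (\<lambda>(i,j). (if i = k then -1 else 1) * P k $$ (i,j) * (if j = k then -1 else 1))"
      unfolding E_def by (subst mat_diag_mult_left[OF Pc], subst mat_diag_mult_right[of _ n]) auto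
    have EPc: "E * P k * E \<in> carrier_mat n n" unfolding EP by simp
    have eq: "P (Suc k) = complex_of_real (1/2) \<cdot>\<^sub>m P k + complex_of_real (1 - 1/2) \<cdot>\<^sub>m (E * P k * E)"
      unfolding EP by (rule eq_matI) (auto simp: P_def less_Suc_eq)
    have "N (P (Suc k)) \<le> N (P k)"
      unfolding eq using symmetric_normD(4)[OF N Pc E E, of k]
      by (intro symmetric_norm_convex[OF N Pc EPc]) auto
    then show ?case using Suc by simp
  qed
  moreover have "P n = mat_diag n (\<lambda>i. M $$ (i,i))" by (rule eq_matI) (auto simp: P_def)
  ultimately show ?thesis by (metis order.refl)
qed

text \<open>A number between 0 and \<open>y k\<close> is a convex combination of \<open>y k\<close>
  and \<open>- y k\<close>, and the sign change is multiplication by a unitary.\<close>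

lemma symmetric_norm_shrink_entry:
  assumes N: "symmetric_norm n N" and "0 \<le> x" "x \<le> y k"
  shows "N (real_diag n (y(k := x))) \<le> N (real_diag n y)"
proof (cases "y k = 0")
  case True
  then have "y(k := x) = y" using assms by auto
  then show ?thesis by simp
next
  case False
  then have yk: "0 < y k" using assms by auto
  define t where "t = (1 + x / y k) / 2"
  have t: "0 \<le> t" "t \<le> 1" using assms yk by (auto simp: t_def field_simps)
  have tx: "(2 * t - 1) * y k = x" using yk by (simp add: t_def field_simps)
  define E where "E = mat_diag n (\<lambda>i. if i = k then -1 else 1 :: complex)"
  have E: "unitary_mat n E" unfolding E_def by (rule unitary_mat_diag) auto
  have EY: "E * real_diag n y = real_diag n (\<lambda>i. (if i = k then - y i else y i))"
    unfolding E_def mat_diag_diag by (rule mat_diag_cong) auto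
  have EYc: "E * real_diag n y \<in> carrier_mat n n" unfolding EY by simp
  have eq: "real_diag n (y(k := x)) =
      complex_of_real t \<cdot>\<^sub>m real_diag n y + complex_of_real (1 - t) \<cdot>\<^sub>m (E * real_diag n y)"
    unfolding EY
  proof (rule eq_matI, goal_cases)
    case (1 i j)
    have "complex_of_real x = complex_of_real (t * y k + (1 - t) * (- y k))"
      using tx by (simp only: of_real_eq_iff) (simp add: algebra_simps)
    moreover have "complex_of_real (y i) = complex_of_real (t * y i + (1 - t) * y i)"
      by (simp only: of_real_eq_iff) (simp add: algebra_simps)
    ultimately show ?case using 1 by (simp del: of_real_diff) (simp add: algebra_simps)
  qed auto
  show ?thesis unfolding eq
    using symmetric_norm_left[OF N _ E, of "real_diag n y"] t
    by (intro symmetric_norm_convex[OF N _ EYc]) auto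
qed

lemma symmetric_norm_diag_mono:
  assumes N: "symmetric_norm n N" and xy: "\<And>i. i < n \<Longrightarrow> 0 \<le> x i" "\<And>i. i < n \<Longrightarrow> x i \<le> y i"
  shows "N (real_diag n x) \<le> N (real_diag n y)"
proof -
  define h where "h k i = (if i < k then x i else y i)" for k i :: nat
  have "N (real_diag n (h k)) \<le> N (real_diag n y)" if "k \<le> n" for k
    using that
  proof (induction k)
    case 0
    then show ?case by (simp add: h_def)
  next
    case (Suc k)
    have "h (Suc k) = (h k)(k := x k)" by (auto simp: h_def fun_eq_iff less_Suc_eq)
    moreover have "N (real_diag n ((h k)(k := x k))) \<le> N (real_diag n (h k))"
      using xy Suc.prems by (intro symmetric_norm_shrink_entry[OF N]) (auto simp: h_def)
    ultimately show ?case using Suc by simp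
  qed
  moreover have "real_diag n (h n) = real_diag n x" by (rule mat_diag_cong) (simp add: h_def)
  ultimately show ?thesis by (metis order.refl)
qed

lemma symmetric_norm_diag_permute:
  assumes N: "symmetric_norm n N" and p: "bij_betw p {..<n} {..<n}"
  shows "N (real_diag n (\<lambda>i. y (p i))) = N (real_diag n y)"
proof -
  have pn: "p i < n" if "i < n" for i using p that by (auto simp: bij_betw_def)
  have pinj: "p i = p j \<longleftrightarrow> i = j" if "i < n" "j < n" for i j
    using p that by (auto simp: bij_betw_def inj_on_def)
  define P where "P = mat n n (\<lambda>(l,i). (if l = p i then 1 else 0 :: complex))"
  have Pc: "P \<in> carrier_mat n n" by (simp add: P_def)
  have P: "unitary_mat n P" unfolding P_def
  proof (rule unitary_of_orthonormal)
    fix i j assume ij: "i < n" "j < n"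
    have "(\<Sum>l<n. cnj (if l = p i then 1 else 0) * (if l = p j then 1 else 0)) =
        (\<Sum>l<n. (if l = p i then (if p i = p j then 1 else 0) else 0 :: complex))"
      by (rule sum.cong) auto
    also have "\<dots> = (if i = j then 1 else 0)" using ij pn pinj by simp
    finally show "(\<Sum>l<n. cnj (if l = p i then 1 else 0) * (if l = p j then 1 else 0)) =
      (if i = j then 1 else 0 :: complex)" .
  qed
  have "mat_adjoint P * real_diag n y * P = real_diag n (\<lambda>i. y (p i))"
  proof (rule eq_matI)
    fix i j assume "i < dim_row (real_diag n (\<lambda>i. y (p i)))" "j < dim_col (real_diag n (\<lambda>i. y (p i)))"
    then have ij: "i < n" "j < n" by auto
    have "(mat_adjoint P * real_diag n y * P) $$ (i,j) = (\<Sum>l<n. cnj (P $$ (l,i)) * y l * P $$ (l,j))"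
      using ij Pc by (subst mult_index[of _ n n _ n])
        (auto simp: mat_diag_mult_right[OF adjoint_carrier[OF Pc]])
    also have "\<dots> = (\<Sum>l<n. (if l = p i then (if p i = p j then complex_of_real (y (p i)) else 0) else 0))"
      using ij by (intro sum.cong refl) (auto simp: P_def)
    also have "\<dots> = (if i = j then complex_of_real (y (p i)) else 0)" using ij pn pinj by simp
    finally show "(mat_adjoint P * real_diag n y * P) $$ (i,j) = real_diag n (\<lambda>i. y (p i)) $$ (i,j)"
      using ij by simp
  qed (use Pc in auto)
  then show ?thesis
    using symmetric_normD(4)[OF N _ unitary_adjoint[OF P] P, of "real_diag n y"] by simp
qed

text \<open>Only \<open>x\<close> has to be sorted. Each step averages \<open>y\<close> with a transposition of itself so that one more
  entry agrees with \<open>x\<close>.\<close>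

lemma symmetric_norm_weak_majorization:
  assumes N: "symmetric_norm n N"
    and anti: "\<And>i j. i \<le> j \<Longrightarrow> j < n \<Longrightarrow> x j \<le> x i" and x0: "\<And>i. i < n \<Longrightarrow> 0 \<le> x i"
    and "\<And>i. i < n \<Longrightarrow> 0 \<le> y i" and "\<And>k. k \<le> n \<Longrightarrow> (\<Sum>i<k. x i) \<le> (\<Sum>i<k. y i)"
  shows "N (real_diag n x) \<le> N (real_diag n y)"
  using assms(4,5)
proof (induction "card {i. i < n \<and> x i \<noteq> y i}" arbitrary: y rule: less_induct)
  case less
  show ?case
  proof (cases "\<forall>i<n. x i \<le> y i")
    case True
    then show ?thesis using x0 by (intro symmetric_norm_diag_mono[OF N]) auto
  next
    case False
    then have ex: "\<exists>j. j < n \<and> y j < x j" by (auto simp: not_le)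
    \<comment> \<open>At the first deficit \<open>j\<close>, the partial sum up to and including
      \<open>j\<close> forces a strict surplus at some earlier \<open>i\<close>, from which mass can
      be moved.\<close>
    define j where "j = (LEAST j. j < n \<and> y j < x j)"
    have j: "j < n" "y j < x j" using LeastI_ex[OF ex] unfolding j_def by auto
    have jl: "x l \<le> y l" if "l < j" for l
      using not_less_Least[of l "\<lambda>j. j < n \<and> y j < x j"] that j unfolding j_def[symmetric] by auto
    have "\<exists>i<j. x i < y i"
    proof (rule ccontr)
      assume "\<not> (\<exists>i<j. x i < y i)"
      then have "(\<Sum>i<j. y i) \<le> (\<Sum>i<j. x i)" by (intro sum_mono) (meson lessThan_iff not_less)
      then have "(\<Sum>i<Suc j. y i) < (\<Sum>i<Suc j. x i)" using j by simp
      moreover have "(\<Sum>i<Suc j. x i) \<le> (\<Sum>i<Suc j. y i)" using j by (intro less.prems(2)) simp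
      ultimately show False by linarith
    qed
    then obtain i where i: "i < j" "x i < y i" by blast
    have xij: "x j \<le> x i" using anti[of i j] i j by simp
    \<comment> \<open>The largest transfer that overshoots neither target: afterwards the entry at
      \<open>i\<close> or at \<open>j\<close> agrees with \<open>x\<close>, which lowers the number
      of disagreements.\<close>
    define \<delta> where "\<delta> = min (y i - x i) (x j - y j)"
    have \<delta>: "0 < \<delta>" "\<delta> \<le> y i - x i" "\<delta> \<le> x j - y j" using i j by (auto simp: \<delta>_def)
    define y' where "y' l = y l - (if l = i then \<delta> else 0) + (if l = j then \<delta> else 0)" for l
    have y'0: "0 \<le> y' l" if "l < n" for l
      using less.prems(1)[OF that] \<delta> x0[of i] i j that by (auto simp: y'_def)
    have sums: "(\<Sum>l<k. x l) \<le> (\<Sum>l<k. y' l)" if k: "k \<le> n" for k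
    proof -
      have eq: "(\<Sum>l<k. y' l) = (\<Sum>l<k. y l) - (if i < k then \<delta> else 0) + (if j < k then \<delta> else 0)"
        by (simp add: y'_def sum.distrib sum_subtractf)
      show ?thesis
      \<comment> \<open>Only sums that contain \<open>i\<close> but not \<open>j\<close> lose
        \<delta>. There every \<open>y l - x l\<close> is nonnegative, and the one at
        \<open>i\<close> alone covers the loss.\<close>
      proof (cases "i < k \<and> k \<le> j")
        case True
        have "y i - x i \<le> (\<Sum>l<k. y l - x l)"
          using True jl by (intro member_le_sum[of i _ "\<lambda>l. y l - x l"]) auto
        then show ?thesis unfolding eq using True \<delta> by (simp add: sum_subtractf)
      next
        case False
        then show ?thesis unfolding eq using less.prems(2)[OF k] i by auto
      qed
    qed
    have "{l. l < n \<and> x l \<noteq> y' l} \<subset> {l. l < n \<and> x l \<noteq> y l}"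
    proof -
      have "{l. l < n \<and> x l \<noteq> y' l} \<subseteq> {l. l < n \<and> x l \<noteq> y l}"
        using i j by (auto simp: y'_def split: if_splits)
      moreover have "x i = y' i \<or> x j = y' j"
        using i by (auto simp: y'_def \<delta>_def min_def)
      moreover have "i \<in> {l. l < n \<and> x l \<noteq> y l}" "j \<in> {l. l < n \<and> x l \<noteq> y l}" using i j by auto
      ultimately show ?thesis by blast
    qed
    then have "card {l. l < n \<and> x l \<noteq> y' l} < card {l. l < n \<and> x l \<noteq> y l}"
      by (intro psubset_card_mono) auto
    then have "N (real_diag n x) \<le> N (real_diag n y')"
      using less.hyps y'0 sums by blast
    also have "\<dots> \<le> N (real_diag n y)"
    proof -
      define p where "p l = (if l = i then j else if l = j then i else l)" for l
      have "bij_betw p {..<n} {..<n}"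
        by (rule bij_betw_byWitness[where f' = p]) (use i j in \<open>auto simp: p_def\<close>)
      then have perm: "N (real_diag n (\<lambda>l. y (p l))) = N (real_diag n y)"
        by (rule symmetric_norm_diag_permute[OF N])
      have yij: "y j < y i" using i j xij by linarith
      \<comment> \<open>Chosen so that averaging \<open>y\<close> with its transposition moves
        exactly \<delta>. That \<delta> does not exceed \<open>y i - y j\<close> rests on
        \<open>x j \<le> x i\<close>: here the order of \<open>x\<close> enters.\<close>
      define t where "t = 1 - \<delta> / (y i - y j)"
      have \<delta>2: "\<delta> \<le> y i - y j" using \<delta>(2) xij j by linarith
      have t: "0 \<le> t" "t \<le> 1" using \<delta> \<delta>2 yij by (auto simp: t_def)
      have td: "(1 - t) * (y i - y j) = \<delta>" using yij by (simp add: t_def)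
      have y't: "y' l = t * y l + (1 - t) * y (p l)" for l
        using td i by (auto simp: y'_def p_def algebra_simps)
      have eq: "real_diag n y' = complex_of_real t \<cdot>\<^sub>m real_diag n y +
          complex_of_real (1 - t) \<cdot>\<^sub>m real_diag n (\<lambda>l. y (p l))"
        by (rule eq_matI) (auto simp: y't)
      show ?thesis unfolding eq
        using perm t by (intro symmetric_norm_convex[OF N]) auto
    qed
    finally show ?thesis .
  qed
qed

section \<open>Congruence by expansive matrices\<close>

text \<open>Columns play the role of vectors: \<open>W W\<^sup>* \<ge> I\<close> becomes the
  statement that multiplication by the adjoint of \<open>W\<close> shortens no column.\<close>

definition col_sqnorm :: "complex mat \<Rightarrow> nat \<Rightarrow> real" where
  "col_sqnorm M j = (\<Sum>i<dim_row M. (cmod (M $$ (i,j)))\<^sup>2)"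

lemma col_sqnorm_gram:
  assumes "j < dim_col M"
  shows "(mat_adjoint M * M) $$ (j,j) = complex_of_real (col_sqnorm M j)"
  unfolding col_sqnorm_def by (rule gram_index_diag) (use assms in auto)

lemma col_sqnorm_unitary:
  assumes U: "unitary_mat n U" and M: "dim_row M = n" "j < dim_col M"
  shows "col_sqnorm (U * M) j = col_sqnorm M j"
proof -
  note Ud = unitary_dim[OF U]
  have "mat_adjoint (U * M) * (U * M) = mat_adjoint M * M"
    using Ud M unitary_cancel[OF U] by (simp add: adjoint_mult mult_assoc_dim)
  moreover have "(mat_adjoint (U * M) * (U * M)) $$ (j,j) = complex_of_real (col_sqnorm (U * M) j)"
    by (rule col_sqnorm_gram) (use M in simp)
  ultimately show ?thesis using col_sqnorm_gram[OF M(2)] by (metis of_real_eq_iff)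
qed

lemma col_sqnorm_mat_diag_mult:
  assumes M: "dim_row M = n" "j < dim_col M"
  shows "col_sqnorm (mat_diag n a * M) j = (\<Sum>i<n. (cmod (a i))\<^sup>2 * (cmod (M $$ (i,j)))\<^sup>2)"
proof -
  have Mc: "M \<in> carrier_mat n (dim_col M)" using M by auto
  show ?thesis unfolding col_sqnorm_def mat_diag_mult_left[OF Mc]
    using M(2) by (simp add: norm_mult power_mult_distrib)
qed

lemma col_sqnorm_unitary_col:
  assumes "unitary_mat n U" "j < n"
  shows "col_sqnorm U j = 1"
proof -
  have "complex_of_real (col_sqnorm U j) = 1"
    using col_sqnorm_gram[of j U] assms(2) unitary_dim[OF assms(1)]
    unfolding unitary_cancel(1)[OF assms(1)] by simp
  then show ?thesis by simp
qed

lemma adjoint_diag_mult_diag_entry: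
  assumes X: "dim_row X = n" "j < dim_col X"
  shows "(mat_adjoint X * real_diag n \<alpha> * X) $$ (j,j) =
    complex_of_real (\<Sum>i<n. \<alpha> i * (cmod (X $$ (i,j)))\<^sup>2)"
proof -
  have Xc: "X \<in> carrier_mat n (dim_col X)" using X by auto
  have "(mat_adjoint X * real_diag n \<alpha> * X) $$ (j,j) = (\<Sum>i<n. cnj (X $$ (i,j)) * \<alpha> i * X $$ (i,j))"
    using X by (subst mult_index[of _ "dim_col X" n _ "dim_col X"])
      (auto simp: mat_diag_mult_right[OF adjoint_carrier[OF Xc]])
  also have "\<dots> = complex_of_real (\<Sum>i<n. \<alpha> i * (cmod (X $$ (i,j)))\<^sup>2)"
    unfolding of_real_sum of_real_mult
    by (intro sum.cong refl) (subst complex_norm_square, simp add: mult_ac)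
  finally show ?thesis .
qed

text \<open>Expansivity enters as singular values at least 1, a condition that passes to the
  adjoint. This is how \<open>Z\<^sup>* Z \<ge> I\<close> yields
  \<open>Z Z\<^sup>* \<ge> I\<close>.\<close>

lemma col_sqnorm_expansive:
  assumes U: "unitary_mat n U" and V: "unitary_mat n V" and s: "\<And>i. i < n \<Longrightarrow> 1 \<le> s i"
    and M: "dim_row M = n" "j < dim_col M"
  shows "col_sqnorm M j \<le> col_sqnorm (U * real_diag n s * mat_adjoint V * M) j"
proof -
  note Ud = unitary_dim[OF U] and Vd = unitary_dim[OF V]
  let ?W = "mat_adjoint V * M"
  have "col_sqnorm M j = col_sqnorm ?W j"
    by (rule col_sqnorm_unitary[symmetric, OF unitary_adjoint[OF V] M])
  also have "\<dots> = (\<Sum>i<n. (cmod (?W $$ (i,j)))\<^sup>2)" using Vd by (simp add: col_sqnorm_def)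
  also have "\<dots> \<le> (\<Sum>i<n. (cmod (complex_of_real (s i)))\<^sup>2 * (cmod (?W $$ (i,j)))\<^sup>2)"
  proof (rule sum_mono)
    fix i assume "i \<in> {..<n}"
    then have "1 * (cmod (?W $$ (i,j)))\<^sup>2 \<le> (cmod (complex_of_real (s i)))\<^sup>2 * (cmod (?W $$ (i,j)))\<^sup>2"
      using s[of i] by (intro mult_right_mono) auto
    then show "(cmod (?W $$ (i,j)))\<^sup>2 \<le> (cmod (complex_of_real (s i)))\<^sup>2 * (cmod (?W $$ (i,j)))\<^sup>2" by simp
  qed
  also have "\<dots> = col_sqnorm (real_diag n s * ?W) j"
    by (rule col_sqnorm_mat_diag_mult[symmetric]) (use Vd M in auto)
  also have "\<dots> = col_sqnorm (U * (real_diag n s * ?W)) j"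
    by (rule col_sqnorm_unitary[symmetric, OF U]) (use M in auto)
  also have "U * (real_diag n s * ?W) = U * real_diag n s * mat_adjoint V * M"
    using Ud Vd M by (simp add: mult_assoc_dim)
  finally show ?thesis .
qed

text \<open>\<open>Q\<close> is the orthogonal projection onto the row space of the rows of \<open>C\<close> selected by \<open>p\<close>. Since
  \<open>C C\<^sup>* \<ge> I\<close>, the selected rows have all nonzero singular values at least 1, hence the last bound.\<close>

lemma row_restriction_projection:
  fixes C :: "complex mat"
  assumes Cc: "C \<in> carrier_mat n n"
    and exp: "\<And>M j. M \<in> carrier_mat n n \<Longrightarrow> j < n \<Longrightarrow> col_sqnorm M j \<le> col_sqnorm (mat_adjoint C * M) j"
  obtains Q where "Q \<in> carrier_mat n n" "mat_adjoint Q = Q" "\<And>j. j < n \<Longrightarrow> col_sqnorm Q j \<le> 1"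
    "\<And>i j. i < n \<Longrightarrow> j < n \<Longrightarrow> p i \<Longrightarrow> (C * Q) $$ (i,j) = C $$ (i,j)"
    "\<And>j. j < n \<Longrightarrow> col_sqnorm Q j \<le> (\<Sum>i<n. (if p i then (cmod (C $$ (i,j)))\<^sup>2 else 0))"
proof -
  define P where "P = mat_diag n (\<lambda>i. if p i then 1 else 0 :: complex)"
  have Pd: "P \<in> carrier_mat n n" "dim_row P = n" "dim_col P = n" by (auto simp: P_def)
  have PP: "P * P = P" unfolding P_def mat_diag_diag by (rule mat_diag_cong) auto
  have Pa: "mat_adjoint P = P" unfolding P_def adjoint_mat_diag by (rule mat_diag_cong) auto
  have Pi: "(P * M) $$ (i,j) = (if p i then M $$ (i,j) else 0)"
    if "M \<in> carrier_mat n n" "i < n" "j < n" for M i j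
    unfolding P_def mat_diag_mult_left[OF that(1)] using that by simp
  define Y where "Y = P * C"
  have Yc: "Y \<in> carrier_mat n n" using Cc Pd(1) by (auto simp: Y_def)
  obtain U s V where U: "unitary_mat n U" and V: "unitary_mat n V"
    and Y: "Y = U * real_diag n s * mat_adjoint V"
    and s0: "\<And>i. i < n \<Longrightarrow> 0 \<le> s i"
    using singular_value_decomposition[OF Yc] by blast
  note Ud = unitary_dim[OF U] and Vd = unitary_dim[OF V]
  have PY: "P * Y = Y" unfolding Y_def using Cc Pd PP by (simp flip: mult_assoc_dim)
  have YV: "Y * V = U * real_diag n s"
    unfolding Y using Ud Vd unitary_cancel[OF V] by (simp add: mult_assoc_dim)
  have PUS: "P * (U * real_diag n s) = U * real_diag n s"
    unfolding YV[symmetric] using PY Pd Yc Vd by (simp flip: mult_assoc_dim)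
  have USc: "U * real_diag n s \<in> carrier_mat n n" using Ud(1) by auto
  \<comment> \<open>For a nonzero singular value the left singular vector is supported on the rows
    selected by \<open>p\<close>; hence the adjoint of \<open>C\<close> sends it to a vector of
    length \<open>s r\<close>, and \<open>exp\<close> applies.\<close>
  have s1: "1 \<le> (s r)\<^sup>2" if r: "r < n" "s r \<noteq> 0" for r
  proof -
    have PU: "(P * U) $$ (i,r) = U $$ (i,r)" if "i < n" for i
    proof -
      have US: "(U * real_diag n s) $$ (i,r) = U $$ (i,r) * s r"
        unfolding mat_diag_mult_right[OF Ud(1)] using that r by simp
      have "(if p i then (U * real_diag n s) $$ (i,r) else 0) = (U * real_diag n s) $$ (i,r)"
        unfolding Pi[OF USc that r(1), symmetric] PUS ..
      then have "(if p i then U $$ (i,r) * s r else 0) = U $$ (i,r) * s r" unfolding US .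
      then show ?thesis unfolding Pi[OF Ud(1) that r(1)] using r by (auto split: if_splits)
    qed
    have "mat_adjoint C * (P * U) = mat_adjoint Y * U"
      using Cc Pd Ud Pa by (simp add: Y_def adjoint_mult mult_assoc_dim)
    also have "\<dots> = V * real_diag n s"
      unfolding Y using Ud Vd unitary_cancel[OF U] by (simp add: adjoint_mult mult_assoc_dim)
    finally have CPU: "mat_adjoint C * (P * U) = V * real_diag n s" .
    have "1 = col_sqnorm (P * U) r"
      using col_sqnorm_unitary_col[OF U r(1)] PU Pd Ud by (simp add: col_sqnorm_def)
    also have "\<dots> \<le> col_sqnorm (mat_adjoint C * (P * U)) r"
      using Pd(1) Ud(1) r by (intro exp) auto
    also have "\<dots> = col_sqnorm (real_diag n s) r"
      unfolding CPU by (rule col_sqnorm_unitary[OF V]) (use r in auto)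
    also have "\<dots> = (\<Sum>i<n. if i = r then (s r)\<^sup>2 else 0)"
      unfolding col_sqnorm_def using r by (intro sum.cong) auto
    also have "\<dots> = (s r)\<^sup>2" using r by simp
    finally show ?thesis .
  qed
  define e where "e r = (if s r = 0 then 0 else 1 :: real)" for r
  define Q where "Q = V * real_diag n e * mat_adjoint V"
  have Qc: "Q \<in> carrier_mat n n" using Vd by (intro carrier_matI) (simp_all add: Q_def)
  have Qa: "mat_adjoint Q = Q"
    unfolding Q_def using Vd by (simp add: adjoint_mult mult_assoc_dim)
  have Qn: "col_sqnorm Q j = (\<Sum>r<n. (e r)\<^sup>2 * (cmod (mat_adjoint V $$ (r,j)))\<^sup>2)" if "j < n" for j
  proof -
    have "col_sqnorm Q j = col_sqnorm (V * (real_diag n e * mat_adjoint V)) j"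
      unfolding Q_def using Vd by (simp add: mult_assoc_dim)
    also have "\<dots> = col_sqnorm (real_diag n e * mat_adjoint V) j"
      by (rule col_sqnorm_unitary[OF V]) (use Vd that in auto)
    finally show ?thesis using Vd that by (simp add: col_sqnorm_mat_diag_mult)
  qed
  have Yn: "col_sqnorm Y j = (\<Sum>r<n. (s r)\<^sup>2 * (cmod (mat_adjoint V $$ (r,j)))\<^sup>2)" if "j < n" for j
  proof -
    have "col_sqnorm Y j = col_sqnorm (U * (real_diag n s * mat_adjoint V)) j"
      unfolding Y using Ud Vd by (simp add: mult_assoc_dim)
    also have "\<dots> = col_sqnorm (real_diag n s * mat_adjoint V) j"
      by (rule col_sqnorm_unitary[OF U]) (use Vd that in auto)
    finally show ?thesis using Vd that by (simp add: col_sqnorm_mat_diag_mult)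
  qed
  show ?thesis
  proof (rule that[OF Qc Qa])
    fix j assume j: "j < n"
    have "col_sqnorm Q j \<le> (\<Sum>r<n. 1 * (cmod (mat_adjoint V $$ (r,j)))\<^sup>2)"
      unfolding Qn[OF j] by (intro sum_mono mult_right_mono) (auto simp: e_def)
    also have "\<dots> = col_sqnorm (mat_adjoint V) j" using Vd by (simp add: col_sqnorm_def)
    also have "\<dots> = 1" by (rule col_sqnorm_unitary_col[OF unitary_adjoint[OF V] j])
    finally show "col_sqnorm Q j \<le> 1" .
    have "col_sqnorm Q j \<le> col_sqnorm Y j"
      unfolding Qn[OF j] Yn[OF j] using s1 by (intro sum_mono mult_right_mono) (auto simp: e_def)
    also have "\<dots> = (\<Sum>i<n. (if p i then (cmod (C $$ (i,j)))\<^sup>2 else 0))"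
      using Pd by (auto simp: col_sqnorm_def Y_def Pi[OF Cc _ j] simp del: index_mult_mat(1) intro!: sum.cong)
    finally show "col_sqnorm Q j \<le> (\<Sum>i<n. (if p i then (cmod (C $$ (i,j)))\<^sup>2 else 0))" .
  next
    fix i j assume ij: "i < n" "j < n" "p i"
    have "Y * Q = U * (real_diag n s * real_diag n e) * mat_adjoint V"
      unfolding Y Q_def using Ud Vd unitary_cancel[OF V]
      by (simp add: mult_assoc_dim del: mat_diag_diag)
    also have "real_diag n s * real_diag n e = real_diag n s"
      unfolding mat_diag_diag by (rule mat_diag_cong) (simp add: e_def)
    finally have "Y * Q = Y" using Y by simp
    then have "P * (C * Q) = P * C" unfolding Y_def using Cc Qc Pd by (simp add: mult_assoc_dim)
    moreover have "C * Q \<in> carrier_mat n n" using Cc Qc by auto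
    ultimately show "(C * Q) $$ (i,j) = C $$ (i,j)"
      using Pi[of "C * Q" i j] Pi[OF Cc, of i j] ij by (metis (full_types))
  qed
qed

text \<open>With \<open>g t = max 0 (t - a)\<close> and \<open>Q\<close> the projection for the rows where \<open>a < \<alpha> i\<close>, one has
  \<open>C\<^sup>* g(\<alpha>) C \<le> Q g(lam) Q\<close>, and the weights \<open>cmod (Q $$ (l,j))\<^sup>2\<close> are doubly substochastic.\<close>

lemma cutoff_partial_sums:
  fixes C :: "complex mat"
  assumes Cc: "C \<in> carrier_mat n n"
    and exp: "\<And>M j. M \<in> carrier_mat n n \<Longrightarrow> j < n \<Longrightarrow> col_sqnorm M j \<le> col_sqnorm (mat_adjoint C * M) j"
    and CC: "mat_adjoint C * real_diag n \<alpha> * C = real_diag n lam"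
    and al: "\<And>i. i < n \<Longrightarrow> 0 \<le> \<alpha> i" and anti: "\<And>i j. i \<le> j \<Longrightarrow> j < n \<Longrightarrow> lam j \<le> lam i"
    and "0 < a" "k \<le> n"
  shows "(\<Sum>j<k. \<Sum>i<n. max 0 (\<alpha> i - a) * (cmod (C $$ (i,j)))\<^sup>2) \<le> (\<Sum>j<k. max 0 (lam j - a))"
proof -
  obtain Q where Qc: "Q \<in> carrier_mat n n" and Qa: "mat_adjoint Q = Q"
    and Q1: "\<And>j. j < n \<Longrightarrow> col_sqnorm Q j \<le> 1"
    and CQ: "\<And>i j. i < n \<Longrightarrow> j < n \<Longrightarrow> a < \<alpha> i \<Longrightarrow> (C * Q) $$ (i,j) = C $$ (i,j)"
    and QC: "\<And>j. j < n \<Longrightarrow> col_sqnorm Q j \<le> (\<Sum>i<n. (if a < \<alpha> i then (cmod (C $$ (i,j)))\<^sup>2 else 0))"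
    using row_restriction_projection[OF Cc exp, of "\<lambda>i. a < \<alpha> i"] by blast
  define q where "q l j = (cmod (Q $$ (l,j)))\<^sup>2" for l j
  have Qsum: "col_sqnorm Q j = (\<Sum>l<n. q l j)" for j using Qc by (simp add: col_sqnorm_def q_def)
  have qsym: "q l j = q j l" if "l < n" "j < n" for l j
    using arg_cong[OF Qa, of "\<lambda>M. cmod (M $$ (l,j))"] that Qc by (simp add: q_def)
  have col: "(\<Sum>i<n. max 0 (\<alpha> i - a) * (cmod (C $$ (i,j)))\<^sup>2) \<le> (\<Sum>l<n. max 0 (lam l - a) * q l j)"
    if j: "j < n" for j
  proof -
    \<comment> \<open>On the selected rows \<open>C * Q\<close> agrees with \<open>C\<close>; on the
      others \<open>\<alpha> i * ?c i\<close> is nonnegative and may be added to the bound.\<close>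
    let ?c = "\<lambda>i. (cmod ((C * Q) $$ (i,j)))\<^sup>2"
    have "mat_adjoint (C * Q) * real_diag n \<alpha> * (C * Q) = mat_adjoint Q * (mat_adjoint C * real_diag n \<alpha> * C) * Q"
      using Cc Qc by (simp add: adjoint_mult mult_assoc_dim)
    also have "\<dots> = mat_adjoint Q * real_diag n lam * Q" unfolding CC ..
    finally have "complex_of_real (\<Sum>i<n. \<alpha> i * ?c i) = complex_of_real (\<Sum>l<n. lam l * q l j)"
      unfolding q_def using Cc Qc j
      by (subst (1 2) adjoint_diag_mult_diag_entry[symmetric]) (simp_all del: index_mult_mat(1))
    then have eq: "(\<Sum>i<n. \<alpha> i * ?c i) = (\<Sum>l<n. lam l * q l j)" using of_real_eq_iff by blast
    have "(\<Sum>i<n. max 0 (\<alpha> i - a) * (cmod (C $$ (i,j)))\<^sup>2) \<le>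
        (\<Sum>i<n. \<alpha> i * ?c i - a * (if a < \<alpha> i then (cmod (C $$ (i,j)))\<^sup>2 else 0))"
    proof (rule sum_mono)
      fix i assume "i \<in> {..<n}"
      then have i: "i < n" by simp
      show "max 0 (\<alpha> i - a) * (cmod (C $$ (i,j)))\<^sup>2 \<le>
        \<alpha> i * ?c i - a * (if a < \<alpha> i then (cmod (C $$ (i,j)))\<^sup>2 else 0)"
      proof (cases "a < \<alpha> i")
        case True
        then show ?thesis unfolding CQ[OF i j True] by (simp add: left_diff_distrib)
      next
        case False
        then show ?thesis using al[OF i] by (simp del: index_mult_mat(1))
      qed
    qed
    also have "\<dots> = (\<Sum>l<n. lam l * q l j) - a * (\<Sum>i<n. (if a < \<alpha> i then (cmod (C $$ (i,j)))\<^sup>2 else 0))"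
      unfolding sum_subtractf eq by (simp only: sum_distrib_left)
    \<comment> \<open>The selected rows of \<open>C\<close> carry at least the mass of column
      \<open>j\<close> of \<open>Q\<close>; the factor \<open>- a\<close> turns this into an upper
      bound.\<close>
    also have "\<dots> \<le> (\<Sum>l<n. lam l * q l j) - a * (\<Sum>l<n. q l j)"
      using mult_left_mono[OF QC[OF j], of a] \<open>0 < a\<close> unfolding Qsum by simp
    also have "\<dots> = (\<Sum>l<n. (lam l - a) * q l j)"
      by (simp add: left_diff_distrib sum_subtractf sum_distrib_left)
    also have "\<dots> \<le> (\<Sum>l<n. max 0 (lam l - a) * q l j)"
      by (intro sum_mono mult_right_mono) (auto simp: q_def)
    finally show ?thesis .
  qed
  have "(\<Sum>j<k. \<Sum>i<n. max 0 (\<alpha> i - a) * (cmod (C $$ (i,j)))\<^sup>2) \<le>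
      (\<Sum>j<k. \<Sum>l<n. max 0 (lam l - a) * q l j)"
    using \<open>k \<le> n\<close> by (intro sum_mono col) simp
  also have "\<dots> = (\<Sum>l<n. max 0 (lam l - a) * (\<Sum>j<k. q l j))"
    unfolding sum_distrib_left by (rule sum.swap)
  also have "\<dots> \<le> (\<Sum>l<k. max 0 (lam l - a))"
  \<comment> \<open>Column sums of \<open>q\<close> are at most 1, and by symmetry so are row sums;
    the weights therefore lie in [0,1] and total at most \<open>k\<close>.\<close>
  proof (rule weighted_sum_le_initial_sum)
    show "max 0 (lam j - a) \<le> max 0 (lam i - a)" if "i \<le> j" "j < n" for i j
      using anti[OF that] by auto
    show "0 \<le> (\<Sum>j<k. q l j)" for l by (intro sum_nonneg) (simp add: q_def)
    show "(\<Sum>j<k. q l j) \<le> 1" if l: "l < n" for l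
    proof -
      have "(\<Sum>j<k. q l j) \<le> (\<Sum>j<n. q l j)"
        using \<open>k \<le> n\<close> by (intro sum_mono2) (auto simp: q_def)
      also have "\<dots> = (\<Sum>j<n. q j l)" by (intro sum.cong refl qsym l) simp
      finally show ?thesis using Q1[OF l] Qsum by simp
    qed
    have "(\<Sum>l<n. \<Sum>j<k. q l j) = (\<Sum>j<k. col_sqnorm Q j)" unfolding Qsum by (rule sum.swap)
    also have "\<dots> \<le> (\<Sum>j<k. 1)" using \<open>k \<le> n\<close> by (intro sum_mono Q1) simp
    finally show "(\<Sum>l<n. \<Sum>j<k. q l j) \<le> real k" by simp
  qed (use \<open>k \<le> n\<close> in auto)
  finally show ?thesis .
qed

section \<open>Singular values of congruences of normal matrices\<close>

text \<open>The weighted arithmetic-geometric mean inequality; the weight \<open>s\<close> will be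
  slightly above an eigenvalue.\<close>

lemma Re_cnj_mult_le: "2 * Re (cnj a * b) \<le> s * (cmod a)\<^sup>2 + (cmod b)\<^sup>2 / s" if "0 < s"
proof -
  have "2 * Re (cnj a * b) \<le> 2 * (cmod a * cmod b)"
    using complex_Re_le_cmod[of "cnj a * b"] by (simp add: norm_mult)
  moreover have "0 \<le> (sqrt s * cmod a - cmod b / sqrt s)\<^sup>2" by simp
  moreover have "(sqrt s * cmod a - cmod b / sqrt s)\<^sup>2 = s * (cmod a)\<^sup>2 + (cmod b)\<^sup>2 / s - 2 * (cmod a * cmod b)"
    using that by (simp add: power2_diff power_mult_distrib power_divide)
  ultimately show ?thesis by linarith
qed

text \<open>The difference of the two sides is \<open>(cmod ((p - q) / 2))\<^sup>2\<close>.\<close>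

lemma Re_cnj_mult_le_avg: "Re (cnj q * p) \<le> (cmod ((p + q) / 2))\<^sup>2"
proof -
  have "0 \<le> (Re p - Re q)\<^sup>2 + (Im p - Im q)\<^sup>2" by simp
  moreover have "(cmod ((p + q) / 2))\<^sup>2 = ((Re p + Re q)\<^sup>2 + (Im p + Im q)\<^sup>2) / 4"
    by (simp add: norm_divide power_divide cmod_power2)
  ultimately show ?thesis by (simp add: power2_eq_square algebra_simps)
qed

lemma cmod_avg_square:
  "2 * (cmod ((p + q) / 2))\<^sup>2 = Re (cnj p * ((p + q) / 2)) + Re (cnj q * ((p + q) / 2))"
proof -
  have "(cmod ((p + q) / 2))\<^sup>2 = ((Re p + Re q)\<^sup>2 + (Im p + Im q)\<^sup>2) / 4"
    by (simp add: norm_divide power_divide cmod_power2)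
  then show ?thesis by (simp add: power2_eq_square field_simps)
qed

lemma adjoint_mult_entry:
  assumes "u \<in> carrier_mat n 1" "v \<in> carrier_mat n 1"
  shows "(mat_adjoint u * v) $$ (0,0) = (\<Sum>l<n. cnj (u $$ (l,0)) * v $$ (l,0))"
  using assms by (subst mult_index[of _ 1 n _ 1]) auto

lemma col_sqnorm_vec: "u \<in> carrier_mat n 1 \<Longrightarrow> col_sqnorm u 0 = (\<Sum>l<n. (cmod (u $$ (l,0)))\<^sup>2)"
  by (simp add: col_sqnorm_def)

lemma inner_le_scaled_sqnorms:
  assumes "u \<in> carrier_mat n 1" "v \<in> carrier_mat n 1" "0 < s"
  shows "2 * Re ((mat_adjoint u * v) $$ (0,0)) \<le> s * col_sqnorm u 0 + col_sqnorm v 0 / s"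
proof -
  have "2 * Re ((mat_adjoint u * v) $$ (0,0)) = (\<Sum>l<n. 2 * Re (cnj (u $$ (l,0)) * v $$ (l,0)))"
    unfolding adjoint_mult_entry[OF assms(1,2)] Re_sum sum_distrib_left ..
  also have "\<dots> \<le> (\<Sum>l<n. s * (cmod (u $$ (l,0)))\<^sup>2 + (cmod (v $$ (l,0)))\<^sup>2 / s)"
    by (intro sum_mono Re_cnj_mult_le assms)
  also have "\<dots> = s * col_sqnorm u 0 + col_sqnorm v 0 / s"
    unfolding col_sqnorm_vec[OF assms(1)] col_sqnorm_vec[OF assms(2)]
    by (simp add: sum.distrib sum_distrib_left sum_divide_distrib)
  finally show ?thesis .
qed

text \<open>The right-hand side of \<open>T\<close> is twice \<open>S S\<^sup>*\<close> for the \<open>n \<times> 2n\<close> matrix \<open>S = [B, \<Phi>\<^sup>* B] / \<surd>2\<close>. Singular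
  vectors \<open>v\<close>, \<open>u\<close> of \<open>B\<^sup>* \<Phi> B\<close> are paired into \<open>(v, u) / \<surd>2\<close>, on which \<open>S\<^sup>* S\<close> dominates the singular value;
  the min-max argument is then run on the images \<open>\<eta>\<close> of these vectors.\<close>

lemma singular_value_le_eigenvalue:
  fixes B \<Phi> :: "complex mat"
  assumes Bc: "B \<in> carrier_mat n n" and \<Phi>: "unitary_mat n \<Phi>"
    and P: "unitary_mat n P" and Q: "unitary_mat n Q" and E: "unitary_mat n E"
    and X: "mat_adjoint B * \<Phi> * B = P * real_diag n \<sigma> * mat_adjoint Q"
    and \<sigma>: "\<And>i j. i \<le> j \<Longrightarrow> j < n \<Longrightarrow> \<sigma> j \<le> \<sigma> i"
    and T: "B * mat_adjoint B + mat_adjoint \<Phi> * (B * mat_adjoint B) * \<Phi> =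
      2 \<cdot>\<^sub>m (E * real_diag n lam * mat_adjoint E)"
    and lam: "\<And>i j. i \<le> j \<Longrightarrow> j < n \<Longrightarrow> lam j \<le> lam i" and j: "j < n" and lam0: "0 \<le> lam j"
  shows "\<sigma> j \<le> lam j"
proof (rule field_le_epsilon)
  fix \<epsilon> :: real assume "0 < \<epsilon>"
  \<comment> \<open>The summand \<epsilon> keeps \<open>s\<close> positive when
    \<open>lam j = 0\<close>, since \<open>s\<close> occurs as a divisor.\<close>
  define s where "s = lam j + \<epsilon>"
  have s: "0 < s" "lam j \<le> s" using \<open>0 < \<epsilon>\<close> lam0 by (auto simp: s_def)
  note d = unitary_dim[OF \<Phi>] unitary_dim[OF P] unitary_dim[OF Q] unitary_dim[OF E] carrier_matD[OF Bc]
  \<comment> \<open>Column \<open>l\<close> of \<open>K\<close> is the image under \<open>S\<close>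
    of the pair formed from the \<open>l\<close>-th columns of \<open>Q\<close> and
    \<open>P\<close>, scaled by \<open>1 / \<surd>2\<close>.\<close>
  define K where "K = (1/2 :: complex) \<cdot>\<^sub>m (B * Q + mat_adjoint \<Phi> * (B * P))"
  have Kc: "K \<in> carrier_mat n n" using d by (intro carrier_matI) (auto simp: K_def)
  define G where "G = mat_adjoint E * K"
  have Gc: "G \<in> carrier_mat n n" using d Kc by (intro carrier_matI) (auto simp: G_def)
  \<comment> \<open>These are \<open>n - 1\<close> equations in \<open>n\<close> unknowns. The first
    \<open>j\<close> make the image orthogonal to the eigenvectors before index \<open>j\<close>;
    each later row \<open>i\<close> sets coordinate \<open>Suc i\<close> to 0, which leaves the
    coordinates up to \<open>j\<close>.\<close>
  define m where "m i l = (if i < j then G $$ (i,l) else if l = Suc i then 1 else 0)" for i l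
  obtain v where v: "\<exists>l<n. v l \<noteq> 0" "\<forall>i<n-1. (\<Sum>l<n. m i l * v l) = 0"
    using homogeneous_system_nontrivial[of "n - 1" n m] j by auto
  have v0: "v l = 0" if "j < l" "l < n" for l
  proof -
    have "(\<Sum>i<n. m (l - 1) i * v i) = (\<Sum>i<n. if i = l then v i else 0)"
      using that by (intro sum.cong refl) (auto simp: m_def)
    then show ?thesis using v(2) that by simp
  qed
  define c where "c = mat n 1 (\<lambda>(l,_). v l)"
  have cc: "c \<in> carrier_mat n 1" and cd: "dim_row c = n" "dim_col c = 1" by (auto simp: c_def)
  have c0: "0 < col_sqnorm c 0"
  proof -
    obtain l where l: "l < n" "v l \<noteq> 0" using v(1) by auto
    have "(cmod (v l))\<^sup>2 \<le> (\<Sum>l<n. (cmod (v l))\<^sup>2)"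
      using l by (intro member_le_sum) auto
    then show ?thesis using l unfolding col_sqnorm_vec[OF cc]
      by (simp add: c_def) (smt (verit) zero_less_norm_iff zero_less_power)
  qed
  define x where "x = Q * c"
  define y where "y = P * c"
  define p where "p = B * x"
  define q where "q = mat_adjoint \<Phi> * (B * y)"
  define \<eta> where "\<eta> = K * c"
  have xc: "x \<in> carrier_mat n 1" and yc: "y \<in> carrier_mat n 1" and pc: "p \<in> carrier_mat n 1"
    and qc: "q \<in> carrier_mat n 1" and \<eta>c: "\<eta> \<in> carrier_mat n 1"
    using d cd Kc by (auto simp: x_def y_def p_def q_def \<eta>_def intro!: carrier_matI)
  note cds = carrier_matD[OF xc] carrier_matD[OF yc] carrier_matD[OF pc] carrier_matD[OF qc]
    carrier_matD[OF \<eta>c] cd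
  have nx: "col_sqnorm x 0 = col_sqnorm c 0" unfolding x_def by (rule col_sqnorm_unitary[OF Q]) (auto simp: cd)
  have ny: "col_sqnorm y 0 = col_sqnorm c 0" unfolding y_def by (rule col_sqnorm_unitary[OF P]) (auto simp: cd)
  have \<eta>pq: "\<eta> = (1/2 :: complex) \<cdot>\<^sub>m (p + q)"
  proof -
    have "\<eta> = (1/2 :: complex) \<cdot>\<^sub>m ((B * Q + mat_adjoint \<Phi> * (B * P)) * c)"
      unfolding \<eta>_def K_def by (rule mult_smult_assoc_mat[of _ n n _ 1]) (use d cd in auto)
    also have "(B * Q + mat_adjoint \<Phi> * (B * P)) * c = B * Q * c + mat_adjoint \<Phi> * (B * P) * c"
      by (rule add_mult_distrib_mat[of _ n n _ _ 1]) (use d cd in \<open>auto intro!: carrier_matI\<close>)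
    also have "\<dots> = p + q"
      using d cd by (simp add: p_def q_def x_def y_def mult_assoc_dim)
    finally show ?thesis .
  qed
  have \<eta>i: "\<eta> $$ (l,0) = (p $$ (l,0) + q $$ (l,0)) / 2" if "l < n" for l
    unfolding \<eta>pq using that cds by simp
  \<comment> \<open>On the singular pairs up to index \<open>j\<close> the form of
    \<open>B\<^sup>* \<Phi> B\<close> is at least \<open>\<sigma> j\<close>. It is an inner product
    of \<open>p\<close> and \<open>q\<close>, hence at most the squared length of their mean
    \<eta>.\<close>
  have low: "\<sigma> j * col_sqnorm c 0 \<le> col_sqnorm \<eta> 0"
  proof -
    have "mat_adjoint q * p = mat_adjoint y * (mat_adjoint B * \<Phi> * B) * x"
      using d cds by (simp add: q_def p_def adjoint_mult mult_assoc_dim)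
    also have "\<dots> = mat_adjoint c * real_diag n \<sigma> * c"
      unfolding X x_def y_def using d cd unitary_cancel[OF P] unitary_cancel[OF Q]
      by (simp add: adjoint_mult mult_assoc_dim)
    finally have "Re ((mat_adjoint q * p) $$ (0,0)) = (\<Sum>l<n. \<sigma> l * (cmod (c $$ (l,0)))\<^sup>2)"
      using adjoint_diag_mult_diag_entry[of c n 0 \<sigma>] cd by simp
    moreover have "\<sigma> j * col_sqnorm c 0 \<le> (\<Sum>l<n. \<sigma> l * (cmod (c $$ (l,0)))\<^sup>2)"
      unfolding col_sqnorm_vec[OF cc] sum_distrib_left
    proof (rule sum_mono)
      fix l assume "l \<in> {..<n}"
      then have l: "l < n" by simp
      show "\<sigma> j * (cmod (c $$ (l,0)))\<^sup>2 \<le> \<sigma> l * (cmod (c $$ (l,0)))\<^sup>2"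
      proof (cases "j < l")
        case True
        then show ?thesis using v0 l by (simp add: c_def)
      next
        case False
        then show ?thesis using \<sigma>[of l j] j by (intro mult_right_mono) auto
      qed
    qed
    moreover have "Re ((mat_adjoint q * p) $$ (0,0)) \<le> col_sqnorm \<eta> 0"
      unfolding adjoint_mult_entry[OF qc pc] Re_sum col_sqnorm_vec[OF \<eta>c]
      by (intro sum_mono) (simp only: lessThan_iff \<eta>i Re_cnj_mult_le_avg)
    ultimately show ?thesis by linarith
  qed
  define e where "e = mat_adjoint E * \<eta>"
  have ec: "e \<in> carrier_mat n 1" using d cds by (intro carrier_matI) (auto simp: e_def)
  have e0: "e $$ (i,0) = 0" if "i < j" for i
  proof -
    have "e = G * c" unfolding e_def \<eta>_def G_def using d Kc cd by (simp add: mult_assoc_dim)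
    then have "e $$ (i,0) = (\<Sum>l<n. G $$ (i,l) * c $$ (l,0))"
      using that j by (simp add: mult_index[OF Gc cc] del: index_mult_mat(1))
    also have "\<dots> = (\<Sum>l<n. m i l * v l)" using that by (intro sum.cong) (auto simp: m_def c_def)
    finally show ?thesis using v(2) that j by simp
  qed
  define b1 where "b1 = mat_adjoint B * \<eta>"
  define b2 where "b2 = mat_adjoint B * (\<Phi> * \<eta>)"
  have b1c: "b1 \<in> carrier_mat n 1" and b2c: "b2 \<in> carrier_mat n 1"
    using d cds by (auto simp: b1_def b2_def intro!: carrier_matI)
  \<comment> \<open>\<eta> has no component along the eigenvectors before index \<open>j\<close>, so
    the quadratic form of the right-hand side of \<open>T\<close> is at most
    \<open>2 * lam j\<close> times its squared length.\<close>
  have bb: "col_sqnorm b1 0 + col_sqnorm b2 0 \<le> 2 * (lam j * col_sqnorm \<eta> 0)"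
  proof -
    have R: "mat_adjoint b1 * b1 + mat_adjoint b2 * b2 = 2 \<cdot>\<^sub>m (mat_adjoint e * real_diag n lam * e)"
    proof -
      let ?BB = "B * mat_adjoint B"
      have BBc: "?BB \<in> carrier_mat n n" "mat_adjoint \<Phi> * ?BB * \<Phi> \<in> carrier_mat n n"
        using d by (auto intro!: carrier_matI)
      have "mat_adjoint b1 * b1 + mat_adjoint b2 * b2 =
          mat_adjoint \<eta> * (?BB * \<eta>) + mat_adjoint \<eta> * (mat_adjoint \<Phi> * ?BB * \<Phi> * \<eta>)"
        using d cds by (simp add: b1_def b2_def adjoint_mult mult_assoc_dim)
      also have "\<dots> = mat_adjoint \<eta> * (?BB * \<eta> + mat_adjoint \<Phi> * ?BB * \<Phi> * \<eta>)"
        by (rule mult_add_distrib_mat[symmetric, of _ 1 n _ 1]) (use d cds in \<open>auto intro!: carrier_matI\<close>)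
      also have "?BB * \<eta> + mat_adjoint \<Phi> * ?BB * \<Phi> * \<eta> = (?BB + mat_adjoint \<Phi> * ?BB * \<Phi>) * \<eta>"
        by (rule add_mult_distrib_mat[symmetric, OF BBc \<eta>c])
      also have "\<dots> = 2 \<cdot>\<^sub>m (E * real_diag n lam * mat_adjoint E * \<eta>)"
        unfolding T by (rule mult_smult_assoc_mat[of _ n n _ 1]) (use d cds in \<open>auto intro!: carrier_matI\<close>)
      also have "mat_adjoint \<eta> * (2 \<cdot>\<^sub>m (E * real_diag n lam * mat_adjoint E * \<eta>)) =
          2 \<cdot>\<^sub>m (mat_adjoint \<eta> * (E * real_diag n lam * mat_adjoint E * \<eta>))"
        by (rule mult_smult_distrib[of _ 1 n _ 1]) (use d cds in \<open>auto intro!: carrier_matI\<close>)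
      also have "mat_adjoint \<eta> * (E * real_diag n lam * mat_adjoint E * \<eta>) = mat_adjoint e * real_diag n lam * e"
        using d cds by (simp add: e_def adjoint_mult mult_assoc_dim)
      finally show ?thesis .
    qed
    have "complex_of_real (col_sqnorm b1 0 + col_sqnorm b2 0) = (mat_adjoint b1 * b1 + mat_adjoint b2 * b2) $$ (0,0)"
      using col_sqnorm_gram[of 0 b1] col_sqnorm_gram[of 0 b2] b1c b2c
      by (simp del: index_mult_mat(1))
    also have "\<dots> = 2 * (mat_adjoint e * real_diag n lam * e) $$ (0,0)"
      unfolding R using ec by (simp del: index_mult_mat(1))
    also have "\<dots> = complex_of_real (2 * (\<Sum>i<n. lam i * (cmod (e $$ (i,0)))\<^sup>2))"
      using adjoint_diag_mult_diag_entry[of e n 0 lam] ec by simp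
    finally have "col_sqnorm b1 0 + col_sqnorm b2 0 = 2 * (\<Sum>i<n. lam i * (cmod (e $$ (i,0)))\<^sup>2)"
      using of_real_eq_iff by blast
    also have "(\<Sum>i<n. lam i * (cmod (e $$ (i,0)))\<^sup>2) \<le> (\<Sum>i<n. lam j * (cmod (e $$ (i,0)))\<^sup>2)"
    proof (rule sum_mono)
      fix i assume i: "i \<in> {..<n}"
      show "lam i * (cmod (e $$ (i,0)))\<^sup>2 \<le> lam j * (cmod (e $$ (i,0)))\<^sup>2"
      proof (cases "i < j")
        case True
        then show ?thesis by (simp add: e0)
      next
        case False
        then show ?thesis using lam[of j i] i by (intro mult_right_mono) auto
      qed
    qed
    also have "\<dots> = lam j * col_sqnorm e 0" unfolding col_sqnorm_vec[OF ec] sum_distrib_left ..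
    also have "col_sqnorm e 0 = col_sqnorm \<eta> 0"
      unfolding e_def by (rule col_sqnorm_unitary[OF unitary_adjoint[OF E]]) (use cds in auto)
    finally show ?thesis by simp
  qed
  have pe: "mat_adjoint p * \<eta> = mat_adjoint x * b1"
    using d cds by (simp add: p_def b1_def adjoint_mult mult_assoc_dim)
  have qe: "mat_adjoint q * \<eta> = mat_adjoint y * b2"
    using d cds by (simp add: q_def b2_def adjoint_mult mult_assoc_dim)
  have "2 * col_sqnorm \<eta> 0 = Re ((mat_adjoint p * \<eta>) $$ (0,0)) + Re ((mat_adjoint q * \<eta>) $$ (0,0))"
  proof -
    have "2 * (cmod (\<eta> $$ (l,0)))\<^sup>2 = Re (cnj (p $$ (l,0)) * \<eta> $$ (l,0)) + Re (cnj (q $$ (l,0)) * \<eta> $$ (l,0))"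
      if "l < n" for l
      unfolding \<eta>i[OF that] by (rule cmod_avg_square)
    then show ?thesis
      unfolding adjoint_mult_entry[OF pc \<eta>c] adjoint_mult_entry[OF qc \<eta>c] Re_sum
        col_sqnorm_vec[OF \<eta>c] sum_distrib_left sum.distrib[symmetric]
      by (intro sum.cong) auto
  qed
  \<comment> \<open>Splitting both products with weight \<open>s\<close> gives \<open>4 *
    |\<eta>|\<^sup>2 \<le> 2 * s * |c|\<^sup>2 + 2 * |\<eta>|\<^sup>2\<close>, so half of the left
    side is absorbed.\<close>
  then have "4 * col_sqnorm \<eta> 0 = 2 * Re ((mat_adjoint x * b1) $$ (0,0)) + 2 * Re ((mat_adjoint y * b2) $$ (0,0))"
    unfolding pe qe by simp
  also have "\<dots> \<le> (s * col_sqnorm x 0 + col_sqnorm b1 0 / s) + (s * col_sqnorm y 0 + col_sqnorm b2 0 / s)"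
    by (intro add_mono inner_le_scaled_sqnorms[OF xc b1c s(1)] inner_le_scaled_sqnorms[OF yc b2c s(1)])
  also have "\<dots> = 2 * s * col_sqnorm c 0 + (col_sqnorm b1 0 + col_sqnorm b2 0) / s"
    unfolding nx ny by (simp add: add_divide_distrib)
  also have "(col_sqnorm b1 0 + col_sqnorm b2 0) / s \<le> 2 * col_sqnorm \<eta> 0"
  proof -
    have "0 \<le> col_sqnorm \<eta> 0" unfolding col_sqnorm_def by (intro sum_nonneg) auto
    then have "lam j * col_sqnorm \<eta> 0 \<le> s * col_sqnorm \<eta> 0" using s by (intro mult_right_mono)
    then have "col_sqnorm b1 0 + col_sqnorm b2 0 \<le> 2 * col_sqnorm \<eta> 0 * s" using bb by (simp add: mult_ac)
    then show ?thesis using s by (simp add: divide_le_eq)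
  qed
  finally have "col_sqnorm \<eta> 0 \<le> s * col_sqnorm c 0" by simp
  then have "\<sigma> j * col_sqnorm c 0 \<le> s * col_sqnorm c 0" using low by linarith
  then have "\<sigma> j \<le> s" using c0 by simp
  then show "\<sigma> j \<le> lam j + \<epsilon>" by (simp add: s_def)
qed

lemma mult_add_dim:
  fixes A B C :: "complex mat"
  assumes "dim_col A = dim_row B" "dim_row B = dim_row C" "dim_col B = dim_col C"
  shows "A * (B + C) = A * B + A * C"
  by (rule mult_add_distrib_mat[of _ "dim_row A" "dim_col A" _ "dim_col B"]) (use assms in auto)

lemma add_mult_dim:
  fixes A B C :: "complex mat"
  assumes "dim_col A = dim_row C" "dim_row A = dim_row B" "dim_col A = dim_col B"
  shows "(A + B) * C = A * C + B * C"
  by (rule add_mult_distrib_mat[of _ "dim_row A" "dim_col A" _ _ "dim_col C"]) (use assms in auto)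

lemma mult_smult_dim:
  fixes A B :: "complex mat"
  assumes "dim_col A = dim_row B"
  shows "A * (c \<cdot>\<^sub>m B) = c \<cdot>\<^sub>m (A * B)" "(c \<cdot>\<^sub>m A) * B = c \<cdot>\<^sub>m (A * B)"
proof -
  show "A * (c \<cdot>\<^sub>m B) = c \<cdot>\<^sub>m (A * B)"
    by (rule mult_smult_distrib[of _ "dim_row A" "dim_col A" _ "dim_col B"]) (use assms in auto)
  show "(c \<cdot>\<^sub>m A) * B = c \<cdot>\<^sub>m (A * B)"
    by (rule mult_smult_assoc_mat[of _ "dim_row A" "dim_col A" _ "dim_col B"]) (use assms in auto)
qed

text \<open>Column \<open>i\<close> of \<open>V\<close> is a unit eigenvector of
  \<open>Z\<^sup>* Z\<close> for \<open>(s i)\<^sup>2\<close>; the form of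
  \<open>Z\<^sup>* Z - I\<close> takes the value \<open>(s i)\<^sup>2 - 1\<close> there.\<close>

lemma expansive_singular_value_ge_one:
  assumes Z: "expansive_mat n Z" and U: "unitary_mat n U" and V: "unitary_mat n V"
    and svd: "Z = U * real_diag n s * mat_adjoint V" and s0: "0 \<le> s i" and i: "i < n"
  shows "1 \<le> s i"
proof -
  note Ud = unitary_dim[OF U] and Vd = unitary_dim[OF V]
  define M where "M = mat_adjoint Z * Z - 1\<^sub>m n"
  have Zc: "Z \<in> carrier_mat n n" and psd: "psd_mat n M"
    using Z by (auto simp: expansive_mat_def loewner_le_def M_def)
  have Mc: "M \<in> carrier_mat n n" using psd by (simp add: psd_mat_def)
  have vc: "col V i \<in> carrier_vec n" using Vd i by auto
  have ZZc: "mat_adjoint Z * Z \<in> carrier_mat n n" using Zc by (intro carrier_matI) auto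
  have "M * V = mat_adjoint Z * Z * V - 1\<^sub>m n * V"
    unfolding M_def by (rule minus_mult_distrib_mat[OF ZZc _ Vd(1)]) simp
  also have "1\<^sub>m n * V = V" using Vd(1) by (rule left_mult_one_mat)
  also have "mat_adjoint Z * Z * V = V * real_diag n (\<lambda>i. (s i)\<^sup>2)"
    unfolding svd using Ud Vd unitary_cancel[OF U] unitary_cancel[OF V]
    by (simp add: adjoint_mult mult_assoc_dim power2_eq_square)
  finally have MV: "M * V = V * real_diag n (\<lambda>i. (s i)\<^sup>2) - V" .
  have VD: "V * real_diag n (\<lambda>i. (s i)\<^sup>2) \<in> carrier_mat n n" using Vd by (intro carrier_matI) auto
  have "(M *\<^sub>v col V i) \<bullet>c col V i = (\<Sum>k<n. (M * V) $$ (k,i) * cnj (V $$ (k,i)))"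
    using Mc Vd i by (simp add: scalar_prod_def atLeast0LessThan)
  also have "\<dots> = (\<Sum>k<n. complex_of_real (((s i)\<^sup>2 - 1) * (cmod (V $$ (k,i)))\<^sup>2))"
  proof (intro sum.cong refl)
    fix k assume "k \<in> {..<n}"
    then have k: "k < n" by simp
    have MVk: "(M * V) $$ (k,i) = V $$ (k,i) * (s i)\<^sup>2 - V $$ (k,i)"
      unfolding MV mat_diag_mult_right[OF Vd(1)] using k i Vd by simp
    have "(M * V) $$ (k,i) * cnj (V $$ (k,i)) = complex_of_real ((s i)\<^sup>2 - 1) * (V $$ (k,i) * cnj (V $$ (k,i)))"
      unfolding MVk by (simp add: algebra_simps)
    then show "(M * V) $$ (k,i) * cnj (V $$ (k,i)) = complex_of_real (((s i)\<^sup>2 - 1) * (cmod (V $$ (k,i)))\<^sup>2)"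
      unfolding of_real_mult complex_norm_square .
  qed
  also have "\<dots> = complex_of_real (((s i)\<^sup>2 - 1) * col_sqnorm V i)"
    unfolding of_real_sum[symmetric] by (simp add: col_sqnorm_def Vd sum_distrib_left)
  also have "col_sqnorm V i = 1" by (rule col_sqnorm_unitary_col[OF V i])
  finally have "0 \<le> (s i)\<^sup>2 - 1" using psd vc unfolding psd_mat_def by (metis Re_complex_of_real mult.right_neutral)
  then have "1\<^sup>2 \<le> (s i)\<^sup>2" by simp
  then show ?thesis using s0 by (rule power2_le_imp_le)
qed

text \<open>Both products are unitarily similar to the diagonal of squared singular values. Hence
  the norm of \<open>C\<^sup>* f(\<alpha>) C\<close> depends on \<open>C\<close> only through
  \<open>C C\<^sup>*\<close>.\<close>

lemma symmetric_norm_gram_swap: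
  assumes N: "symmetric_norm n N" and Y: "Y \<in> carrier_mat n n"
  shows "N (Y * mat_adjoint Y) = N (mat_adjoint Y * Y)"
proof -
  obtain U s V where U: "unitary_mat n U" and V: "unitary_mat n V"
    and svd: "Y = U * real_diag n s * mat_adjoint V"
    using singular_value_decomposition[OF Y] by metis
  note Ud = unitary_dim[OF U] and Vd = unitary_dim[OF V]
  have "Y * mat_adjoint Y = U * real_diag n (\<lambda>i. s i * s i) * mat_adjoint U"
    "mat_adjoint Y * Y = V * real_diag n (\<lambda>i. s i * s i) * mat_adjoint V"
    unfolding svd using Ud Vd unitary_cancel[OF U] unitary_cancel[OF V] by (simp_all add: adjoint_mult mult_assoc_dim flip: mat_diag_diag)
  then show ?thesis
    using symmetric_normD(4)[OF N _ U unitary_adjoint[OF U]] symmetric_normD(4)[OF N _ V unitary_adjoint[OF V]]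
    by simp
qed

theorem theorem3p1:
  fixes n :: nat and A Z :: "complex mat" and f :: "real \<Rightarrow> real"
    and N :: "complex mat \<Rightarrow> real"
  assumes "A \<in> carrier_mat n n" and "normal_mat n A"
    and "Z \<in> carrier_mat n n" and "expansive_mat n Z"
    and "\<forall>x \<ge> 0. f x \<ge> 0" and "concave_on {0..} f"
    and "symmetric_norm n N"
  shows "N (mat_fun n f (mat_abs n (mat_adjoint Z * A * Z)))
         \<le> N (mat_adjoint Z * mat_fun n f (mat_abs n A) * Z)"
proof -
  note N = assms(7) and fnn = assms(5) and conc = assms(6)
  have Zd: "dim_row Z = n" "dim_col Z = n" using assms(3) by auto
  obtain W a where W: "unitary_mat n W" and AW: "A = W * mat_diag n a * mat_adjoint W"
    using normal_spectral[OF assms(2)] by blast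
  note Wd = unitary_dim[OF W]
  define \<alpha> where "\<alpha> i = cmod (a i)" for i
  \<comment> \<open>At a zero of \<open>a\<close> the phase is arbitrary; the value 1 keeps \<Phi>
    unitary.\<close>
  define \<phi> where "\<phi> i = (if a i = 0 then 1 else a i / complex_of_real (cmod (a i)))" for i
  have \<alpha>0: "0 \<le> \<alpha> i" for i by (simp add: \<alpha>_def)
  have f\<alpha>0: "0 \<le> f (\<alpha> i)" for i using fnn \<alpha>0 by blast
  define \<Phi> where "\<Phi> = mat_diag n \<phi>"
  have \<Phi>: "unitary_mat n \<Phi>" unfolding \<Phi>_def
    by (rule unitary_mat_diag) (simp add: \<phi>_def norm_divide)
  have fA: "mat_fun n f (mat_abs n A) = W * real_diag n (\<lambda>i. f (\<alpha> i)) * mat_adjoint W"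
    unfolding AW mat_abs_svd[OF W W] mat_fun_unitary_diag[OF W] \<alpha>_def ..

  \<comment> \<open>Absorbing \<open>W\<close> into \<open>Z\<close> makes \<open>A\<close> diagonal
    on both sides of the claim.\<close>
  define Z1 where "Z1 = mat_adjoint W * Z"
  have Z1c: "Z1 \<in> carrier_mat n n" using Wd Zd by (intro carrier_matI) (auto simp: Z1_def)
  have rhs: "mat_adjoint Z * mat_fun n f (mat_abs n A) * Z =
      mat_adjoint Z1 * real_diag n (\<lambda>i. f (\<alpha> i)) * Z1"
    unfolding fA Z1_def using Wd Zd by (simp add: adjoint_mult mult_assoc_dim)
  have XZ: "mat_adjoint Z * A * Z = mat_adjoint Z1 * mat_diag n a * Z1"
    unfolding AW Z1_def using Wd Zd by (simp add: adjoint_mult mult_assoc_dim)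
  obtain U0 s0 V0 where U0: "unitary_mat n U0" and V0: "unitary_mat n V0"
    and Zsvd: "Z = U0 * real_diag n s0 * mat_adjoint V0" and s0: "\<And>i. i < n \<Longrightarrow> 0 \<le> s0 i"
    using singular_value_decomposition[OF assms(3)] by metis
  note U0d = unitary_dim[OF U0] and V0d = unitary_dim[OF V0]
  have s01: "1 \<le> s0 i" if "i < n" for i
    by (rule expansive_singular_value_ge_one[OF assms(4) U0 V0 Zsvd s0[OF that] that])
  have Z1a: "mat_adjoint Z1 = V0 * real_diag n s0 * mat_adjoint (mat_adjoint W * U0)"
    unfolding Z1_def Zsvd using Wd U0d V0d by (simp add: adjoint_mult mult_assoc_dim)
  \<comment> \<open>This is \<open>K \<ge> I\<close> in terms of columns: the adjoint of
    \<open>Z1\<close> has the singular values of \<open>Z\<close>.\<close>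
  have expZ: "col_sqnorm M j \<le> col_sqnorm (mat_adjoint Z1 * M) j" if "M \<in> carrier_mat n n" "j < n" for M j
    unfolding Z1a
    by (rule col_sqnorm_expansive[OF V0 unitary_mult[OF unitary_adjoint[OF W] U0] s01]) (use that in auto)

  define R where "R = real_diag n (\<lambda>i. sqrt (\<alpha> i))"
  define F where "F = real_diag n (\<lambda>i. sqrt (f (\<alpha> i)))"
  have RR: "R * R = real_diag n \<alpha>" and FF: "F * F = real_diag n (\<lambda>i. f (\<alpha> i))"
    using \<alpha>0 f\<alpha>0 by (auto simp: R_def F_def simp flip: of_real_mult)
  have Ra: "mat_adjoint R = R" and Fa: "mat_adjoint F = F" by (auto simp: R_def F_def)
  have Rd: "dim_row R = n" "dim_col R = n" and Fd: "dim_row F = n" "dim_col F = n"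
    by (auto simp: R_def F_def)
  have R\<Phi>: "R * \<Phi> = \<Phi> * R" and F\<Phi>: "F * \<Phi> = \<Phi> * F"
    by (auto simp: R_def F_def \<Phi>_def mult.commute)
  have R\<Phi>': "mat_adjoint \<Phi> * R = R * mat_adjoint \<Phi>" and F\<Phi>': "mat_adjoint \<Phi> * F = F * mat_adjoint \<Phi>"
    by (auto simp: R_def F_def \<Phi>_def mult.commute)
  have R\<Phi>R: "\<Phi> * (R * R) = mat_diag n a"
    unfolding RR \<Phi>_def mat_diag_diag by (rule mat_diag_cong) (auto simp: \<phi>_def \<alpha>_def)
  note \<Phi>d = unitary_dim[OF \<Phi>] and Z1d = carrier_matD[OF Z1c]

  \<comment> \<open>Splitting \<alpha> evenly between the two sides leaves the unitary \<Phi> in the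
    middle, the form required by \<open>singular_value_le_eigenvalue\<close>.\<close>
  define B where "B = R * Z1"
  have Bc: "B \<in> carrier_mat n n" using Rd Z1d by (intro carrier_matI) (auto simp: B_def)
  have BX: "mat_adjoint B * \<Phi> * B = mat_adjoint Z1 * mat_diag n a * Z1"
  proof -
    have "mat_adjoint B * \<Phi> * B = mat_adjoint Z1 * (R * \<Phi> * R) * Z1"
      unfolding B_def using Rd Z1d \<Phi>d Ra by (simp add: adjoint_mult mult_assoc_dim)
    also have "R * \<Phi> * R = \<Phi> * (R * R)" unfolding R\<Phi> using Rd \<Phi>d by (simp add: mult_assoc_dim)
    finally show ?thesis unfolding R\<Phi>R .
  qed
  obtain P \<sigma> Q where P: "unitary_mat n P" and Q: "unitary_mat n Q"
    and Xsvd: "mat_adjoint B * \<Phi> * B = P * real_diag n \<sigma> * mat_adjoint Q"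
    and \<sigma>0: "\<And>i. i < n \<Longrightarrow> 0 \<le> \<sigma> i" and \<sigma>anti: "\<And>i j. i \<le> j \<Longrightarrow> j < n \<Longrightarrow> \<sigma> j \<le> \<sigma> i"
  proof -
    have "mat_adjoint B * \<Phi> * B \<in> carrier_mat n n" using Bc \<Phi>d by (intro carrier_matI) auto
    from singular_value_decomposition[OF this] that show ?thesis by metis
  qed
  have lhs: "N (mat_fun n f (mat_abs n (mat_adjoint Z * A * Z))) = N (real_diag n (\<lambda>i. f (\<sigma> i)))"
  proof -
    have "real_diag n (\<lambda>i. cmod (complex_of_real (\<sigma> i))) = real_diag n \<sigma>"
      using \<sigma>0 by (intro mat_diag_cong) simp
    then have "mat_fun n f (mat_abs n (mat_adjoint Z * A * Z)) = Q * real_diag n (\<lambda>i. f (\<sigma> i)) * mat_adjoint Q"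
      unfolding XZ BX[symmetric] Xsvd mat_abs_svd[OF P Q] by (simp only: mat_fun_unitary_diag[OF Q])
    then show ?thesis using symmetric_normD(4)[OF N _ Q unitary_adjoint[OF Q]] by simp
  qed

  define K where "K = Z1 * mat_adjoint Z1"
  define L where "L = (1/2 :: complex) \<cdot>\<^sub>m (K + mat_adjoint \<Phi> * K * \<Phi>)"
  have Kd: "dim_row K = n" "dim_col K = n" using Z1d by (auto simp: K_def)
  have Ld: "dim_row L = n" "dim_col L = n" using Kd \<Phi>d by (auto simp: L_def)
  have Ka: "mat_adjoint K = K" unfolding K_def using Z1d by (simp add: adjoint_mult)
  have La: "mat_adjoint L = L"
    unfolding L_def using Kd \<Phi>d Ka by (simp add: adjoint_smult adjoint_add adjoint_mult mult_assoc_dim)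
  obtain U d where U: "unitary_mat n U" and LU: "L = U * real_diag n d * mat_adjoint U"
    using hermitian_spectral_sorted[of L n] Ld La by (metis carrier_matI)
  note Ud = unitary_dim[OF U]
  \<comment> \<open>The diagonal of \<open>U\<^sup>* L U\<close> is the mean of the squared column
    lengths of \<open>Z1\<^sup>* U\<close> and \<open>Z1\<^sup>* \<Phi> U\<close>, each at least
    1.\<close>
  have d1: "1 \<le> d i" if i: "i < n" for i
  proof -
    let ?u = "mat_adjoint Z1 * U" and ?w = "mat_adjoint Z1 * (\<Phi> * U)"
    have "mat_adjoint U * L * U = real_diag n d"
      unfolding LU using Ud unitary_cancel[OF U] by (simp add: mult_assoc_dim)
    moreover have "mat_adjoint U * L * U = (1/2 :: complex) \<cdot>\<^sub>m (mat_adjoint ?u * ?u + mat_adjoint ?w * ?w)"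
      unfolding L_def K_def using Ud \<Phi>d Z1d
      by (simp add: adjoint_mult mult_assoc_dim mult_smult_dim mult_add_dim add_mult_dim)
    ultimately have "real_diag n d $$ (i,i) = ((1/2 :: complex) \<cdot>\<^sub>m (mat_adjoint ?u * ?u + mat_adjoint ?w * ?w)) $$ (i,i)"
      by (simp only:)
    also have "\<dots> = (1/2) * ((mat_adjoint ?u * ?u) $$ (i,i) + (mat_adjoint ?w * ?w) $$ (i,i))"
      using Ud \<Phi>d Z1d i by (simp del: index_mult_mat(1))
    also have "\<dots> = complex_of_real ((col_sqnorm ?u i + col_sqnorm ?w i) / 2)"
      using col_sqnorm_gram[of i ?u] col_sqnorm_gram[of i ?w] Ud \<Phi>d i by (simp del: index_mult_mat(1))
    finally have "d i = (col_sqnorm ?u i + col_sqnorm ?w i) / 2"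
      using i by (simp only: mat_diag_index of_real_eq_iff if_True refl)
    moreover have "1 \<le> col_sqnorm ?u i"
      using expZ[OF Ud(1) i] col_sqnorm_unitary_col[OF U i] by simp
    moreover have "1 \<le> col_sqnorm ?w i"
      using expZ[OF unitary_dim(1)[OF unitary_mult[OF \<Phi> U]] i]
        col_sqnorm_unitary_col[OF unitary_mult[OF \<Phi> U] i] by simp
    ultimately show ?thesis by simp
  qed

  define G where "G = U * real_diag n (\<lambda>i. sqrt (d i))"
  have Gd: "dim_row G = n" "dim_col G = n" using Ud by (auto simp: G_def)
  have GG: "G * mat_adjoint G = L"
  proof -
    have "G * mat_adjoint G = U * (real_diag n (\<lambda>i. sqrt (d i)) * real_diag n (\<lambda>i. sqrt (d i))) * mat_adjoint U"
      unfolding G_def using Ud by (simp add: adjoint_mult mult_assoc_dim del: mat_diag_diag)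
    also have "real_diag n (\<lambda>i. sqrt (d i)) * real_diag n (\<lambda>i. sqrt (d i)) = real_diag n d"
      unfolding mat_diag_diag
    proof (rule mat_diag_cong)
      fix i assume "i < n"
      then show "complex_of_real (sqrt (d i)) * complex_of_real (sqrt (d i)) = complex_of_real (d i)"
        using d1[of i] by (simp flip: of_real_mult)
    qed
    finally show ?thesis using LU by simp
  qed
  \<comment> \<open>One decomposition serves two ends: \<open>E\<close> diagonalises
    \<open>R L R\<close>, whose eigenvalues dominate \<sigma>, and \<open>V\<close> diagonalises
    \<open>G\<^sup>* \<alpha> G\<close> with the same eigenvalues.\<close>
  obtain E s V where E: "unitary_mat n E" and V: "unitary_mat n V"
    and Ysvd: "R * G = E * real_diag n s * mat_adjoint V"
    and s0': "\<And>i. i < n \<Longrightarrow> 0 \<le> s i" and santi: "\<And>i j. i \<le> j \<Longrightarrow> j < n \<Longrightarrow> s j \<le> s i"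
  proof -
    have "R * G \<in> carrier_mat n n" using Rd Gd by (intro carrier_matI) auto
    from singular_value_decomposition[OF this] that show ?thesis by metis
  qed
  note Ed = unitary_dim[OF E] and Vd = unitary_dim[OF V]
  define lam where "lam i = s i * s i" for i
  have lam0: "0 \<le> lam i" for i by (simp add: lam_def)
  have lamanti: "lam j \<le> lam i" if "i \<le> j" "j < n" for i j
    unfolding lam_def using santi[OF that] s0'[of j] s0'[of i] that by (intro mult_mono) auto
  have RLR: "R * L * R = E * real_diag n lam * mat_adjoint E"
  proof -
    have "R * L * R = (R * G) * mat_adjoint (R * G)"
      unfolding GG[symmetric] using Rd Gd Ra by (simp add: adjoint_mult mult_assoc_dim)
    also have "\<dots> = E * (real_diag n s * real_diag n s) * mat_adjoint E"
      unfolding Ysvd using Ed Vd unitary_cancel[OF V]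
      by (simp add: adjoint_mult mult_assoc_dim del: mat_diag_diag)
    finally show ?thesis by (simp add: lam_def)
  qed
  \<comment> \<open>\<Phi> commutes with \<open>R\<close>, so conjugating \<open>R K R\<close> by it
    acts on \<open>K\<close> alone.\<close>
  have T: "B * mat_adjoint B + mat_adjoint \<Phi> * (B * mat_adjoint B) * \<Phi> =
      2 \<cdot>\<^sub>m (E * real_diag n lam * mat_adjoint E)"
  proof -
    have B1: "B * mat_adjoint B = R * K * R"
      unfolding B_def K_def using Rd Z1d Ra by (simp add: adjoint_mult mult_assoc_dim)
    have "mat_adjoint \<Phi> * (R * K * R) * \<Phi> = (mat_adjoint \<Phi> * R) * K * (R * \<Phi>)"
      using Rd Kd \<Phi>d by (simp add: mult_assoc_dim)
    also have "\<dots> = R * (mat_adjoint \<Phi> * K * \<Phi>) * R"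
      unfolding R\<Phi> R\<Phi>' using Rd Kd \<Phi>d by (simp add: mult_assoc_dim)
    finally have B2: "mat_adjoint \<Phi> * (B * mat_adjoint B) * \<Phi> = R * (mat_adjoint \<Phi> * K * \<Phi>) * R"
      unfolding B1 .
    have "2 \<cdot>\<^sub>m L = K + mat_adjoint \<Phi> * K * \<Phi>"
      unfolding L_def using Kd \<Phi>d by (intro eq_matI) (simp_all del: index_mult_mat(1))
    then have "2 \<cdot>\<^sub>m (R * L * R) = R * (K + mat_adjoint \<Phi> * K * \<Phi>) * R"
      using Rd Ld by (simp add: mult_smult_dim flip: \<open>2 \<cdot>\<^sub>m L = _\<close>)
    also have "\<dots> = B * mat_adjoint B + mat_adjoint \<Phi> * (B * mat_adjoint B) * \<Phi>"
      unfolding B2 unfolding B1 using Rd Kd \<Phi>d by (simp add: mult_add_dim add_mult_dim)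
    finally show ?thesis unfolding RLR by simp
  qed
  have \<sigma>lam: "\<sigma> j \<le> lam j" if "j < n" for j
    by (rule singular_value_le_eigenvalue[OF Bc \<Phi> P Q E Xsvd _ T]) (use \<sigma>anti lamanti lam0 that in auto)

  \<comment> \<open>A unitary factor on the right does not change \<open>G G\<^sup>*\<close>; this
    one makes the congruence of \<alpha> diagonal.\<close>
  define C where "C = G * V"
  have Cc: "C \<in> carrier_mat n n" using Gd Vd by (intro carrier_matI) (auto simp: C_def)
  note Cd = carrier_matD[OF Cc]
  have CC: "C * mat_adjoint C = L"
    unfolding C_def GG[symmetric] using Gd Vd unitary_cancel[OF V] by (simp add: adjoint_mult mult_assoc_dim)
  have CE: "C = U * real_diag n (\<lambda>i. sqrt (d i)) * mat_adjoint (mat_adjoint V)"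
    by (simp add: C_def G_def)
  have Ca: "mat_adjoint C = mat_adjoint V * real_diag n (\<lambda>i. sqrt (d i)) * mat_adjoint U"
    unfolding C_def G_def using Ud Vd by (simp add: adjoint_mult mult_assoc_dim)
  have sd1: "1 \<le> sqrt (d i)" if "i < n" for i using d1[OF that] by simp
  have expC: "col_sqnorm M j \<le> col_sqnorm (mat_adjoint C * M) j" if "M \<in> carrier_mat n n" "j < n" for M j
    unfolding Ca by (rule col_sqnorm_expansive[OF unitary_adjoint[OF V] U sd1]) (use that in auto)
  \<comment> \<open>The constant function 1 needs the columns of \<open>C\<close> itself, so the
    expansive bound is applied to \<open>C\<close>, not to its adjoint, and tested on the identity
    matrix.\<close>
  have colC: "1 \<le> col_sqnorm C j" if "j < n" for j
  proof -
    have "col_sqnorm (1\<^sub>m n) j \<le> col_sqnorm (C * 1\<^sub>m n) j"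
      unfolding CE by (rule col_sqnorm_expansive[OF U unitary_adjoint[OF V] sd1]) (use that in auto)
    then show ?thesis using col_sqnorm_unitary_col[OF unitary_one that] right_mult_one_mat[OF Cc] by simp
  qed
  have Cdiag: "mat_adjoint C * real_diag n \<alpha> * C = real_diag n lam"
  proof -
    have "mat_adjoint C * real_diag n \<alpha> * C = mat_adjoint V * (mat_adjoint (R * G) * (R * G)) * V"
      unfolding RR[symmetric] C_def using Rd Gd Vd Ra by (simp add: adjoint_mult mult_assoc_dim)
    also have "\<dots> = real_diag n s * real_diag n s"
      unfolding Ysvd using Ed Vd unitary_cancel[OF E] unitary_cancel[OF V]
      by (simp add: adjoint_mult mult_assoc_dim del: mat_diag_diag)
    finally show ?thesis by (simp add: lam_def)
  qed
  define m where "m i j = (cmod (C $$ (i,j)))\<^sup>2" for i j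
  \<comment> \<open>Equality for the identity function, used in passing from \<open>max\<close> to
    \<open>min\<close>.\<close>
  have lam_sum: "lam j = (\<Sum>i<n. \<alpha> i * m i j)" if "j < n" for j
  proof -
    have "complex_of_real (lam j) = complex_of_real (\<Sum>i<n. \<alpha> i * m i j)"
      unfolding m_def using adjoint_diag_mult_diag_entry[of C n j \<alpha>] Cd that by (simp add: Cdiag)
    then show ?thesis using of_real_eq_iff by blast
  qed
  have sums: "(\<Sum>j<k. f (lam j)) \<le> (\<Sum>j<k. \<Sum>i<n. f (\<alpha> i) * m i j)" if k: "k \<le> n" for k
  proof (rule concave_sum_le_of_min[OF conc fnn])
    show "1 \<le> (\<Sum>i<n. m i j)" if "j < k" for j
      using colC[of j] that k Cd by (simp add: col_sqnorm_def m_def)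
    show "(\<Sum>j<k. min (lam j) t) \<le> (\<Sum>j<k. \<Sum>i<n. min (\<alpha> i) t * m i j)" if "0 < t" for t
    proof -
      have min_eq: "min x t = x - max 0 (x - t)" for x by (simp add: min_def max_def)
      have "(\<Sum>j<k. \<Sum>i<n. max 0 (\<alpha> i - t) * m i j) \<le> (\<Sum>j<k. max 0 (lam j - t))"
        unfolding m_def by (rule cutoff_partial_sums[OF Cc _ Cdiag]) (use expC \<alpha>0 lamanti that k in auto)
      moreover have "(\<Sum>j<k. \<Sum>i<n. min (\<alpha> i) t * m i j) =
          (\<Sum>j<k. lam j) - (\<Sum>j<k. \<Sum>i<n. max 0 (\<alpha> i - t) * m i j)"
      proof -
        have "(\<Sum>j<k. lam j) = (\<Sum>j<k. \<Sum>i<n. \<alpha> i * m i j)" using k by (intro sum.cong lam_sum) auto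
        then show ?thesis by (simp add: min_eq left_diff_distrib sum_subtractf)
      qed
      moreover have "(\<Sum>j<k. min (lam j) t) = (\<Sum>j<k. lam j) - (\<Sum>j<k. max 0 (lam j - t))"
        by (simp add: min_eq sum_subtractf)
      ultimately show ?thesis by linarith
    qed
  qed (use lam0 \<alpha>0 in auto)

  let ?M = "mat_adjoint C * real_diag n (\<lambda>i. f (\<alpha> i)) * C"
  have "N (real_diag n (\<lambda>i. f (\<sigma> i))) \<le> N (real_diag n (\<lambda>i. f (lam i)))"
    using fnn \<sigma>0 \<sigma>lam by (intro symmetric_norm_diag_mono[OF N] concave_nonneg_mono[OF conc fnn]) auto
  also have "\<dots> \<le> N (real_diag n (\<lambda>j. \<Sum>i<n. f (\<alpha> i) * m i j))"
  proof (rule symmetric_norm_weak_majorization[OF N _ _ _ sums])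
    show "f (lam j) \<le> f (lam i)" if "i \<le> j" "j < n" for i j
      by (intro concave_nonneg_mono[OF conc fnn] lamanti lam0 that)
    show "0 \<le> f (lam i)" for i using fnn lam0 by blast
    show "0 \<le> (\<Sum>i<n. f (\<alpha> i) * m i j)" for j
      by (intro sum_nonneg mult_nonneg_nonneg f\<alpha>0) (simp add: m_def)
  qed
  also have "real_diag n (\<lambda>j. \<Sum>i<n. f (\<alpha> i) * m i j) = mat_diag n (\<lambda>j. ?M $$ (j,j))"
    unfolding m_def
    by (rule mat_diag_cong, rule adjoint_diag_mult_diag_entry[symmetric]) (use Cd in auto)
  also have "N \<dots> \<le> N ?M"
    by (rule symmetric_norm_pinching[OF N]) (use Cd in \<open>intro carrier_matI, auto\<close>)
  also have "?M = mat_adjoint (F * C) * (F * C)"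
    unfolding FF[symmetric] using Fd Cd Fa by (simp add: adjoint_mult mult_assoc_dim)
  \<comment> \<open>In the swapped form \<open>F L F\<close> the dependence on \<open>L\<close> is
    linear, so the average can be split.\<close>
  also have "N \<dots> = N ((F * C) * mat_adjoint (F * C))"
    by (rule symmetric_norm_gram_swap[OF N, symmetric]) (use Fd Cd in \<open>intro carrier_matI, auto\<close>)
  also have "(F * C) * mat_adjoint (F * C) = F * L * F"
    unfolding CC[symmetric] using Fd Cd Fa by (simp add: adjoint_mult mult_assoc_dim)
  \<comment> \<open>The second half is a unitary conjugate of the first because \<Phi> commutes with
    \<open>F\<close>, so both have the same norm.\<close>
  also have "\<dots> = complex_of_real (1/2) \<cdot>\<^sub>m (F * K * F) +
      complex_of_real (1 - 1/2) \<cdot>\<^sub>m (mat_adjoint \<Phi> * (F * K * F) * \<Phi>)"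
  proof -
    have "mat_adjoint \<Phi> * (F * K * F) * \<Phi> = (mat_adjoint \<Phi> * F) * K * (F * \<Phi>)"
      using Fd Kd \<Phi>d by (simp add: mult_assoc_dim)
    also have "\<dots> = F * (mat_adjoint \<Phi> * K * \<Phi>) * F"
      unfolding F\<Phi> F\<Phi>' using Fd Kd \<Phi>d by (simp add: mult_assoc_dim)
    finally have eq: "mat_adjoint \<Phi> * (F * K * F) * \<Phi> = F * (mat_adjoint \<Phi> * K * \<Phi>) * F" .
    have "F * L * F = (1/2) \<cdot>\<^sub>m (F * K * F + F * (mat_adjoint \<Phi> * K * \<Phi>) * F)"
      unfolding L_def using Fd Kd \<Phi>d by (simp add: mult_smult_dim mult_add_dim add_mult_dim)
    also have "\<dots> = (1/2) \<cdot>\<^sub>m (F * K * F) + (1/2) \<cdot>\<^sub>m (F * (mat_adjoint \<Phi> * K * \<Phi>) * F)"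
      by (rule add_smult_distrib_left_mat[of _ n n]) (use Fd Kd \<Phi>d in \<open>auto intro!: carrier_matI\<close>)
    finally show ?thesis unfolding eq by simp
  qed
  also have "N \<dots> \<le> N (F * K * F)"
  proof (rule symmetric_norm_convex[OF N])
    show FKF: "F * K * F \<in> carrier_mat n n" using Fd Kd by (intro carrier_matI) auto
    show "N (mat_adjoint \<Phi> * (F * K * F) * \<Phi>) \<le> N (F * K * F)"
      using symmetric_normD(4)[OF N FKF unitary_adjoint[OF \<Phi>] \<Phi>] by simp
  qed (use Fd Kd \<Phi>d in \<open>auto intro!: carrier_matI\<close>)
  also have "F * K * F = (F * Z1) * mat_adjoint (F * Z1)"
    unfolding K_def using Fd Z1d Fa by (simp add: adjoint_mult mult_assoc_dim)
  also have "N \<dots> = N (mat_adjoint (F * Z1) * (F * Z1))"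
    by (rule symmetric_norm_gram_swap[OF N]) (use Fd Z1d in \<open>intro carrier_matI, auto\<close>)
  also have "mat_adjoint (F * Z1) * (F * Z1) = mat_adjoint Z1 * real_diag n (\<lambda>i. f (\<alpha> i)) * Z1"
    unfolding FF[symmetric] using Fd Z1d Fa by (simp add: adjoint_mult mult_assoc_dim)
  finally show ?thesis unfolding lhs rhs .
qed

end
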